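(* Let $f:\mathbb{R}^n\to\mathbb{R}\cup\{\infty\}$ be a lower semicontinuous proper function with $\bar x\in\operatorname{dom} f$ and $0\in\partial f(\bar x)$. Assume that $f$ is both prox-regular and subdifferentially continuous at $\bar x$ for $\bar v=0$. Let $\kappa>0$. Then the following assertions are equivalent: (i) The point $\bar x$ is a tilt-stable local minimizer of $f$ with modulus $\kappa$. (ii) There is a constant $\eta>0$ such that for all $w\in\mathbb{R}^n$ we have $$\langle z,w\rangle\ge\frac{1}{\kappa}\|w\|^2\quad\text{whenever } z\in D\partial f(u|v)(w)\ \text{ with }\ (u,v)\in\operatorname{gph}\partial f\cap\mathbb{B}_\eta(\bar x,0).$$ Furthermore, if these assertions hold for some $\kappa>0$, then the exact modulus of tilt stability of $f$ at $\bar x$ is $$\operatorname{tilt}(f,\bar x)=\inf_{\eta>0}\ \sup\Big\{\frac{\|w\|^2}{\langle z,w\rangle}\ \Big|\ z\in D\partial f(u|v)(w),\ (u,v)\in\operatorname{gph}\partial f\cap\mathbb{B}_\eta(\bar x,0)\Big\},$$ with the convention $0/0=0$.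
   Context: $\mathbb{B}_r(a)$ denotes the closed ball with center $a$ and radius $r$ (Euclidean norm), and $\operatorname{dom} f=\{x: f(x)<\infty\}$. Tangent and normal cones: for $\Omega\subset\mathbb{R}^d$ and $a\in\Omega$, $T_\Omega(a)=\{v: \exists\, t_k\downarrow 0,\ v_k\to v \text{ with } a+t_kv_k\in\Omega \text{ for all } k\}$; the regular normal cone is $\widehat N_\Omega(a)=\{v:\langle v,w\rangle\le 0\ \forall w\in T_\Omega(a)\}$; the limiting normal cone is $N_\Omega(a)=\{v:\exists\, a_k\to a,\ a_k\in\Omega,\ v_k\in\widehat N_\Omega(a_k),\ v_k\to v\}$. Limiting subdifferential: for $x\in\operatorname{dom} f$, $\partial f(x)=\{v:(v,-1)\in N_{\operatorname{epi} f}(x,f(x))\}$, where $\operatorname{epi} f=\{(x,r): r\ge f(x)\}$; $\partial f(x)=\emptyset$ if $x\notin\operatorname{dom} f$. Its graph is $\operatorname{gph}\partial f=\{(x,v): v\in\partial f(x)\}$. Subgradient graphical derivative: for $(u,v)\in\operatorname{gph}\partial f$, $D\partial f(u|v)(w)=\{z:(w,z)\in T_{\operatorname{gph}\partial f}(u,v)\}$. Prox-regularity: $f$ is prox-regular at $\bar x$ for $\bar v\in\partial f(\bar x)$ if there are $r,\varepsilon>0$ such that for all $x,u\in\mathbb{B}_\varepsilon(\bar x)$ with $|f(u)-f(\bar x)|<\varepsilon$ one has $f(x)\ge f(u)+\langle v,x-u\rangle-\frac r2\|x-u\|^2$ for all $v\in\partial f(u)\cap\mathbb{B}_\varepsilon(\bar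 v)$. Subdifferential continuity: $f$ is subdifferentially continuous at $\bar x$ for $\bar v$ if the mapping $(x,v)\mapsto f(x)$ is continuous relative to $\operatorname{gph}\partial f$ at $(\bar x,\bar v)$. Tilt stability: $\bar x\in\operatorname{dom} f$ is a tilt-stable local minimizer of $f$ with modulus $\kappa>0$ if there is $\gamma>0$ such that the mapping $M_\gamma: v\mapsto\operatorname{argmin}\{f(x)-\langle v,x\rangle : x\in\mathbb{B}_\gamma(\bar x)\}$ is single-valued and Lipschitz continuous with constant $\kappa$ on some neighborhood of $0\in\mathbb{R}^n$, with $M_\gamma(0)=\bar x$. The exact modulus $\operatorname{tilt}(f,\bar x)$ is the infimum of all $\kappa>0$ such that $\bar x$ is a tilt-stable local minimizer of $f$ with modulus $\kappa$. *)

theory Defs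
  imports "HOL-Analysis.Analysis"
begin

text \<open>
  Functions with values in the reals extended by plus infinity are functions into
  \<^typ>\<open>ereal\<close> that never take the value minus infinity; the latter is part of properness.
\<close>

definition effective_domain :: "('a \<Rightarrow> ereal) \<Rightarrow> 'a set" where
  "effective_domain f = {x. f x < \<infinity>}"

definition proper_fun :: "('a \<Rightarrow> ereal) \<Rightarrow> bool" where
  "proper_fun f \<longleftrightarrow> (\<forall>x. f x \<noteq> -\<infinity>) \<and> effective_domain f \<noteq> {}"

definition lower_semicontinuous :: "('a::topological_space \<Rightarrow> ereal) \<Rightarrow> bool" where
  "lower_semicontinuous f \<longleftrightarrow> (\<forall>x. f x \<le> Liminf (at x) f)"

definition epi :: "('a \<Rightarrow> ereal) \<Rightarrow> ('a \<times> real) set" where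
  "epi f = {(x, r). f x \<le> ereal r}"

text \<open>
  The cones below are meant for base points in the set. The definitions do not test this;
  every use below has a base point in the set. The convergence of the scalars
  to zero from above is read as positivity together with convergence to zero.
\<close>

definition tangent_cone :: "'a::real_inner set \<Rightarrow> 'a \<Rightarrow> 'a set" where
  "tangent_cone S a =
     {v. \<exists>(t :: nat \<Rightarrow> real) w.
           (\<forall>k. 0 < t k) \<and> t \<longlonglongrightarrow> 0 \<and> w \<longlonglongrightarrow> v \<and> (\<forall>k. a + t k *\<^sub>R w k \<in> S)}"

definition regular_normal_cone :: "'a::real_inner set \<Rightarrow> 'a \<Rightarrow> 'a set" where
  "regular_normal_cone S a = {v. \<forall>w\<in>tangent_cone S a. v \<bullet> w \<le> 0}"

definition limiting_normal_cone :: "'a::real_inner set \<Rightarrow> 'a \<Rightarrow> 'a set" where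
  "limiting_normal_cone S a =
     {v. \<exists>(b :: nat \<Rightarrow> 'a) w.
           (\<forall>k. b k \<in> S \<and> w k \<in> regular_normal_cone S (b k)) \<and>
           b \<longlonglongrightarrow> a \<and> w \<longlonglongrightarrow> v}"

text \<open>
  \<^const>\<open>real_of_ereal\<close> is harmless here: for proper \<open>f\<close>, points of the effective domain have
  finite values.
\<close>

definition subdifferential :: "('a::real_inner \<Rightarrow> ereal) \<Rightarrow> 'a \<Rightarrow> 'a set" where
  "subdifferential f x =
     (if x \<in> effective_domain f
      then {v. (v, -1) \<in> limiting_normal_cone (epi f) (x, real_of_ereal (f x))}
      else {})"

definition gph :: "('a \<Rightarrow> 'b set) \<Rightarrow> ('a \<times> 'b) set" where
  "gph F = {(x, y). y \<in> F x}"

definition subgradient_graphical_derivative ::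
    "('a::real_inner \<Rightarrow> ereal) \<Rightarrow> 'a \<Rightarrow> 'a \<Rightarrow> 'a \<Rightarrow> 'a set" where
  "subgradient_graphical_derivative f u v w =
     {z. (w, z) \<in> tangent_cone (gph (subdifferential f)) (u, v)}"

definition prox_regular :: "('a::real_inner \<Rightarrow> ereal) \<Rightarrow> 'a \<Rightarrow> 'a \<Rightarrow> bool" where
  "prox_regular f xbar vbar \<longleftrightarrow>
     vbar \<in> subdifferential f xbar \<and>
     (\<exists>r>0. \<exists>\<epsilon>>0. \<forall>x\<in>cball xbar \<epsilon>. \<forall>u\<in>cball xbar \<epsilon>.
        \<bar>f u - f xbar\<bar> < ereal \<epsilon> \<longrightarrow>
        (\<forall>v \<in> subdifferential f u \<inter> cball vbar \<epsilon>.
           f x \<ge> f u + ereal (v \<bullet> (x - u) - r / 2 * (norm (x - u))\<^sup>2)))"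

definition subdifferentially_continuous ::
    "('a::real_inner \<Rightarrow> ereal) \<Rightarrow> 'a \<Rightarrow> 'a \<Rightarrow> bool" where
  "subdifferentially_continuous f xbar vbar \<longleftrightarrow>
     continuous (at (xbar, vbar) within gph (subdifferential f)) (\<lambda>(x, v). f x)"

definition tilt_argmin :: "('a::real_inner \<Rightarrow> ereal) \<Rightarrow> 'a \<Rightarrow> real \<Rightarrow> 'a \<Rightarrow> 'a set" where
  "tilt_argmin f xbar \<gamma> v =
     {x. is_arg_min (\<lambda>y. f y - ereal (v \<bullet> y)) (\<lambda>y. y \<in> cball xbar \<gamma>) x}"

definition tilt_stable_local_minimizer ::
    "('a::real_inner \<Rightarrow> ereal) \<Rightarrow> 'a \<Rightarrow> real \<Rightarrow> bool" where
  "tilt_stable_local_minimizer f xbar \<kappa> \<longleftrightarrow>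
     xbar \<in> effective_domain f \<and> 0 < \<kappa> \<and>
     (\<exists>\<gamma>>0. \<exists>V m. open V \<and> 0 \<in> V \<and>
        (\<forall>v\<in>V. tilt_argmin f xbar \<gamma> v = {m v}) \<and>
        \<kappa>-lipschitz_on V m \<and> m 0 = xbar)"

text \<open>The value is plus infinity if no modulus exists.\<close>

definition tilt :: "('a::real_inner \<Rightarrow> ereal) \<Rightarrow> 'a \<Rightarrow> ereal" where
  "tilt f xbar = Inf {ereal \<kappa> | \<kappa>. tilt_stable_local_minimizer f xbar \<kappa>}"

text \<open>
  Quotients in the formula for the exact modulus are formed in \<^typ>\<open>ereal\<close> and not in
  \<^typ>\<open>real\<close>, where every quotient with denominator zero vanishes.
\<close>

lemma ereal_quotient_convention:
  "ereal 0 / ereal 0 = 0"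
  "0 < a \<Longrightarrow> ereal a / ereal 0 = \<infinity>"
  by (simp_all add: divide_ereal_def)

end

theory Submission
  imports Defs
begin

text \<open>
  Both assertions are equivalent to a third one, uniform quadratic growth with constant
  \<open>c = 1 / \<kappa>\<close>: for all points \<open>(u, v)\<close> of the subdifferential graph near
  \<open>(a, 0)\<close> and all \<open>x\<close> near \<open>a\<close>,
  \<open>f x \<ge> f u + v \<bullet> (x - u) + c / 2 * (norm (x - u))\<^sup>2\<close>.
  The same inequality with \<open>c = - r\<close> is prox-regularity, and with \<open>c = 0\<close> it says that
  \<open>u\<close> minimizes the function tilted by \<open>v\<close>. So everything is phrased with one predicate,
  \<open>quadratic_minorant\<close>, whose constant \<open>c\<close> may have any sign.

  The engine is \<open>lipschitz_resolvent_growth\<close>: if minimizers \<open>P e\<close> of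
  \<open>f x + lam / 2 * (norm (x - a))\<^sup>2 - e \<bullet> (x - a)\<close> depend on \<open>e\<close> with Lipschitz constant
  \<open>L\<close>, then \<open>f\<close> grows quadratically at \<open>P e\<close> with constant \<open>1 / L - lam\<close>. The optimal value
  of this family is a concave function of \<open>e\<close> with supergradient \<open>a - P e\<close>; Lipschitz continuity
  bounds its curvature by \<open>L\<close>. The optimal value at a nearby parameter \<open>w\<close> bounds \<open>f x\<close> from below,
  and the best choice \<open>w = e + (x - P e) / L\<close> gives the growth.

  Tilt stability is the hypothesis of the engine with \<open>lam = 0\<close> and \<open>L = \<kappa>\<close>. This gives growth
  along the pairs \<open>(m v, v)\<close>, where \<open>m\<close> is the argmin mapping. That there are no other pairs in
  the graph near \<open>(a, 0)\<close> follows by comparing both sets through the map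
  \<open>(u, v) \<mapsto> v + lam (u - a)\<close> with \<open>lam > r\<close>: prox-regularity makes it injective on the graph, and
  by Brouwer's theorem the pairs \<open>(m v, v)\<close> already cover a neighborhood of \<open>0\<close>.

  The bound on the graphical derivative follows from growth because two growth inequalities
  add up to \<open>(v' - v) \<bullet> (u' - u) \<ge> c * (norm (u' - u))\<^sup>2\<close>, which survives the passage to tangents.
  Conversely, choose \<open>lam > r\<close>, so that the minimizers \<open>P e\<close> exist, are Lipschitz continuous and
  parametrize the graph. A limit \<open>w\<close> of difference quotients of \<open>P\<close> in direction \<open>d\<close> gives the
  tangent vector \<open>(w, d - lam w)\<close>, so the derivative bound forces
  \<open>(lam + c) * norm w \<le> norm d\<close>. A mean value argument turns this into Lipschitz continuity of
  \<open>P\<close> with constant \<open>1 / (lam + c)\<close>, for which the engine yields growth with constant exactly \<open>c\<close>.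
  Finally, growth with \<open>c = 1 / \<kappa>\<close> gives tilt stability with modulus \<open>\<kappa>\<close>, since tilted minimizers
  exist by lower semicontinuity and the monotonicity inequality makes them Lipschitz.

  The formula for the exact modulus is then a computation with infima: once some derivative
  bound is available, all quotients for small \<open>\<eta>\<close> are nonnegative, and such a supremum is at
  most \<open>\<kappa>\<close> exactly if the bound holds with \<open>1 / \<kappa>\<close>.
\<close>

section \<open>Quadratic minorants\<close>

text \<open>
  Including the membership of \<open>u\<close> in the effective domain keeps \<open>f u\<close> finite for proper \<open>f\<close>;
  with \<open>f u = \<infinity>\<close> the inequality would force \<open>f\<close> to be infinite on \<open>S\<close>.
\<close>
definition quadratic_minorant ::
    "('a::real_inner \<Rightarrow> ereal) \<Rightarrow> 'a set \<Rightarrow> real \<Rightarrow> 'a \<Rightarrow> 'a \<Rightarrow> bool" where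
  "quadratic_minorant f S c u v \<longleftrightarrow>
     u \<in> effective_domain f \<and>
     (\<forall>x\<in>S. f u + ereal (v \<bullet> (x - u) + c / 2 * (norm (x - u))\<^sup>2) \<le> f x)"

lemma proper_fun_real_value:
  assumes "proper_fun f" "u \<in> effective_domain f"
  obtains a where "f u = ereal a"
  using assms unfolding proper_fun_def effective_domain_def
  by (cases "f u") auto

lemma quadratic_minorant_real:
  assumes "proper_fun f" "quadratic_minorant f S c u v" "x \<in> S" "f u = ereal a" "f x = ereal b"
  shows "a + v \<bullet> (x - u) + c / 2 * (norm (x - u))\<^sup>2 \<le> b"
  using assms unfolding quadratic_minorant_def by fastforce

text \<open>
  Proximal subgradients are limiting subgradients, whatever the sign of \<open>c\<close>: along
  \<open>u + t w\<close> the quadratic term is of order \<open>t\<^sup>2\<close> and disappears after division by \<open>t\<close>.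
  This contains the Fermat rule together with the sum rule for a smooth quadratic term.
\<close>
lemma quadratic_minorant_imp_subgradient:
  fixes f :: "'a::real_inner \<Rightarrow> ereal"
  assumes proper: "proper_fun f" and Q: "quadratic_minorant f S c u v" and u: "u \<in> interior S"
  shows "v \<in> subdifferential f u"
proof -
  have dom: "u \<in> effective_domain f"
    using Q by (simp add: quadratic_minorant_def)
  obtain a where a: "f u = ereal a"
    using proper_fun_real_value[OF proper dom] .
  have "(v, -1) \<bullet> p \<le> 0" if p: "p \<in> tangent_cone (epi f) (u, a)" for p
  proof -
    obtain t :: "nat \<Rightarrow> real" and q where t: "\<And>k. 0 < t k" "t \<longlonglongrightarrow> 0" and q: "q \<longlonglongrightarrow> p"
      and mem: "\<And>k. (u, a) + t k *\<^sub>R q k \<in> epi f"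
      using p unfolding tangent_cone_def by blast
    have q1: "(\<lambda>k. fst (q k)) \<longlonglongrightarrow> fst p" and q2: "(\<lambda>k. snd (q k)) \<longlonglongrightarrow> snd p"
      using q by (auto intro: tendsto_fst tendsto_snd)
    have "(\<lambda>k. u + t k *\<^sub>R fst (q k)) \<longlonglongrightarrow> u + 0 *\<^sub>R fst p"
      by (intro tendsto_intros t q1)
    then have "\<forall>\<^sub>F k in sequentially. u + t k *\<^sub>R fst (q k) \<in> interior S"
      using u by (intro topological_tendstoD[OF _ open_interior]) auto
    then have ev: "\<forall>\<^sub>F k in sequentially.
        v \<bullet> fst (q k) + c / 2 * t k * (norm (fst (q k)))\<^sup>2 \<le> snd (q k)"
    proof (rule eventually_mono)
      fix k assume "u + t k *\<^sub>R fst (q k) \<in> interior S"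
      then have "u + t k *\<^sub>R fst (q k) \<in> S"
        using interior_subset by blast
      then have "ereal a + ereal (v \<bullet> (t k *\<^sub>R fst (q k)) + c / 2 * (norm (t k *\<^sub>R fst (q k)))\<^sup>2)
          \<le> f (u + t k *\<^sub>R fst (q k))"
        using Q a unfolding quadratic_minorant_def by fastforce
      also have "\<dots> \<le> ereal (a + t k * snd (q k))"
        using mem[of k] by (cases "q k") (auto simp: epi_def)
      finally have "v \<bullet> (t k *\<^sub>R fst (q k)) + c / 2 * (norm (t k *\<^sub>R fst (q k)))\<^sup>2 \<le> t k * snd (q k)"
        by simp
      then have "t k * (v \<bullet> fst (q k) + c / 2 * t k * (norm (fst (q k)))\<^sup>2) \<le> t k * snd (q k)"
        by (simp add: power_mult_distrib algebra_simps power2_eq_square)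
      then show "v \<bullet> fst (q k) + c / 2 * t k * (norm (fst (q k)))\<^sup>2 \<le> snd (q k)"
        using t(1)[of k] by simp
    qed
    have "(\<lambda>k. v \<bullet> fst (q k) + c / 2 * t k * (norm (fst (q k)))\<^sup>2)
        \<longlonglongrightarrow> v \<bullet> fst p + c / 2 * 0 * (norm (fst p))\<^sup>2"
      by (intro tendsto_intros t q1)
    then have "v \<bullet> fst p + c / 2 * 0 * (norm (fst p))\<^sup>2 \<le> snd p"
      using tendsto_le[OF _ q2 _ ev] by simp
    then show ?thesis
      by (cases p) simp
  qed
  then have reg: "(v, -1) \<in> regular_normal_cone (epi f) (u, a)"
    by (simp add: regular_normal_cone_def)
  have "(u, a) \<in> epi f"
    by (simp add: epi_def a)
  then have "(v, -1) \<in> limiting_normal_cone (epi f) (u, a)"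
    using reg unfolding limiting_normal_cone_def mem_Collect_eq
    by (intro exI[of _ "\<lambda>_::nat. (u, a)"] exI[of _ "\<lambda>_::nat. (v, -1::real)"] conjI allI tendsto_const)
  then show ?thesis
    using dom a by (simp add: subdifferential_def)
qed

text \<open>
  The sum of the two minorant inequalities, each evaluated at the other base point.
\<close>
lemma quadratic_minorant_monotone:
  fixes f :: "'a::real_inner \<Rightarrow> ereal"
  assumes proper: "proper_fun f"
    and Q1: "quadratic_minorant f S c1 u1 v1" and Q2: "quadratic_minorant f S c2 u2 v2"
    and S: "u1 \<in> S" "u2 \<in> S"
  shows "(c1 + c2) / 2 * (norm (u1 - u2))\<^sup>2 \<le> (v1 - v2) \<bullet> (u1 - u2)"
proof -
  have "u1 \<in> effective_domain f" "u2 \<in> effective_domain f"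
    using Q1 Q2 by (auto simp: quadratic_minorant_def)
  then obtain a1 a2 where a: "f u1 = ereal a1" "f u2 = ereal a2"
    using proper_fun_real_value[OF proper] by metis
  have "a1 + v1 \<bullet> (u2 - u1) + c1 / 2 * (norm (u2 - u1))\<^sup>2 \<le> a2"
    "a2 + v2 \<bullet> (u1 - u2) + c2 / 2 * (norm (u1 - u2))\<^sup>2 \<le> a1"
    using quadratic_minorant_real[OF proper] Q1 Q2 S a by blast+
  then show ?thesis
    by (simp add: norm_minus_commute inner_simps algebra_simps add_divide_distrib)
qed

section \<open>Growth from Lipschitz continuous minimizers\<close>

text \<open>
  The hypothesis on \<open>h\<close> makes \<open>- m w\<close> a supergradient of \<open>h\<close> at \<open>w\<close>, so for differentiable
  \<open>h\<close> this is Taylor's bound for an \<open>L\<close>-Lipschitz gradient. To avoid differentiating, the segment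
  from \<open>v\<close> to \<open>w\<close> is cut into \<open>N\<close> pieces; on each piece the supergradient at the far end is compared
  with \<open>m v\<close>. The sum of the errors is \<open>L * (norm (w - v))\<^sup>2 * (N + 1) / (2 * N)\<close>.
\<close>
lemma support_quadratic_bound:
  fixes h :: "'a::real_inner \<Rightarrow> real" and m :: "'a \<Rightarrow> 'a"
  assumes V: "convex V" and lip: "L-lipschitz_on V m"
    and sup: "\<And>v w. v \<in> V \<Longrightarrow> w \<in> V \<Longrightarrow> h v \<le> h w + (w - v) \<bullet> m w"
    and vw: "v \<in> V" "w \<in> V"
  shows "h v - (w - v) \<bullet> m v - L / 2 * (norm (w - v))\<^sup>2 \<le> h w"
proof -
  define d where "d = w - v"
  have L: "0 \<le> L" using lip by (rule lipschitz_on_nonneg)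
  have step: "h v - d \<bullet> m v - L * (norm d)\<^sup>2 * (real (Suc N) / (2 * real N)) \<le> h w" if N: "N > 0" for N :: nat
  proof -
    define p where "p i = v + (real i / real N) *\<^sub>R d" for i
    have pV: "p i \<in> V" if "i \<le> N" for i
    proof -
      have "p i = (1 - real i / real N) *\<^sub>R v + (real i / real N) *\<^sub>R w"
        by (simp add: p_def d_def algebra_simps)
      then show ?thesis
        using convexD[OF V vw, of "1 - real i / real N" "real i / real N"] that N by simp
    qed
    have "h v - (real i / real N) * (d \<bullet> m v) - L * (norm d)\<^sup>2 * (real i * real (Suc i) / (2 * (real N)\<^sup>2)) \<le> h (p i)"
      if "i \<le> N" for i
      using that
    proof (induction i)
      case 0
      then show ?case by (simp add: p_def)
    next
      case (Suc i)
      have diff: "p (Suc i) - p i = (1 / real N) *\<^sub>R d"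
        by (simp add: p_def add_divide_distrib scaleR_left_distrib)
      have "d \<bullet> m (p (Suc i)) - d \<bullet> m v = d \<bullet> (m (p (Suc i)) - m v)"
        by (simp add: inner_diff_right)
      also have "\<dots> \<le> norm d * norm (m (p (Suc i)) - m v)"
        by (rule norm_cauchy_schwarz)
      also have "\<dots> \<le> norm d * (L * norm (p (Suc i) - v))"
        using lipschitz_onD[OF lip pV[OF Suc.prems] vw(1)]
        by (intro mult_left_mono) (auto simp: dist_norm)
      also have "\<dots> = L * (norm d)\<^sup>2 * (real (Suc i) / real N)"
        by (simp add: p_def power2_eq_square)
      finally have "(1 / real N) * (d \<bullet> m (p (Suc i))) \<le> (1 / real N) * (d \<bullet> m v + L * (norm d)\<^sup>2 * (real (Suc i) / real N))"
        by (intro mult_left_mono) auto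
      moreover have "h (p i) \<le> h (p (Suc i)) + (1 / real N) * (d \<bullet> m (p (Suc i)))"
        using sup[OF pV pV, of i "Suc i"] Suc.prems diff by simp
      moreover have "(1 / real N) * (d \<bullet> m v + L * (norm d)\<^sup>2 * (real (Suc i) / real N))
          = (1 / real N) * (d \<bullet> m v) + L * (norm d)\<^sup>2 * (real (Suc i) / (real N)\<^sup>2)"
        by (simp add: power2_eq_square distrib_left del: of_nat_Suc)
      ultimately have "h (p (Suc i)) \<ge> h (p i) - (1 / real N) * (d \<bullet> m v) - L * (norm d)\<^sup>2 * (real (Suc i) / (real N)\<^sup>2)"
        by linarith
      with Suc.IH Suc.prems have "h (p (Suc i)) \<ge> h v - (real i / real N) * (d \<bullet> m v)
          - L * (norm d)\<^sup>2 * (real i * real (Suc i) / (2 * (real N)\<^sup>2))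
          - (1 / real N) * (d \<bullet> m v) - L * (norm d)\<^sup>2 * (real (Suc i) / (real N)\<^sup>2)"
        by linarith
      also have "(real i / real N) * (d \<bullet> m v) = (real (Suc i) / real N) * (d \<bullet> m v) - (1 / real N) * (d \<bullet> m v)"
        by (simp add: add_divide_distrib algebra_simps)
      also have "real i * real (Suc i) / (2 * (real N)\<^sup>2) = real (Suc i) * real (Suc (Suc i)) / (2 * (real N)\<^sup>2) - real (Suc i) / (real N)\<^sup>2"
        using N by (simp add: field_simps)
      finally show ?case
        by (simp add: algebra_simps)
    qed
    from this[of N] have "h v - d \<bullet> m v - L * (norm d)\<^sup>2 * (real N * real (Suc N) / (2 * (real N)\<^sup>2)) \<le> h (p N)"
      using N by simp
    moreover have "p N = w"
      using N by (simp add: p_def d_def)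
    moreover have "real N * real (Suc N) / (2 * (real N)\<^sup>2) = real (Suc N) / (2 * real N)"
      using N by (simp add: power2_eq_square)
    ultimately show ?thesis by (simp only:)
  qed
  have "(\<lambda>N. 1 / 2 + 1 / 2 * inverse (real N)) \<longlonglongrightarrow> 1 / 2 + 1 / 2 * 0"
    by (intro tendsto_intros lim_inverse_n)
  then have "(\<lambda>N. real (Suc N) / (2 * real N)) \<longlonglongrightarrow> 1 / 2"
    unfolding mult_zero_right add_0_right by (rule Lim_transform_eventually)
      (auto simp: eventually_sequentially field_simps intro!: exI[of _ 1])
  then have "(\<lambda>N. h v - d \<bullet> m v - L * (norm d)\<^sup>2 * (real (Suc N) / (2 * real N)))
      \<longlonglongrightarrow> h v - d \<bullet> m v - L * (norm d)\<^sup>2 * (1 / 2)"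
    by (intro tendsto_diff tendsto_mult tendsto_const)
  then have "h v - d \<bullet> m v - L * (norm d)\<^sup>2 * (1 / 2) \<le> h w"
    using step by (intro tendsto_upperbound) (auto simp: eventually_sequentially intro!: exI[of _ 1])
  then show ?thesis
    by (simp add: d_def)
qed

text \<open>
  A local form of the fact that a convex function whose conjugate has an \<open>L\<close>-Lipschitz gradient is
  strongly convex with constant \<open>1 / L\<close>. Up to sign and a translation of \<open>a\<close> to the origin,
  \<open>h\<close> below is that conjugate, taken of \<open>f\<close> plus \<open>lam / 2\<close> times the squared distance to \<open>a\<close>,
  restricted to \<open>S\<close>. The value \<open>h w\<close> for \<open>w\<close> other
  than \<open>e\<close> yields an affine minorant of this function on \<open>S\<close>; the choice of \<open>w\<close> in the proof
  maximizes the resulting lower bound at \<open>x\<close>.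
\<close>
lemma lipschitz_resolvent_growth:
  fixes f :: "'a::real_inner \<Rightarrow> ereal" and P :: "'a \<Rightarrow> 'a"
  assumes proper: "proper_fun f"
    and Y: "convex Y" and L: "0 < L" and lip: "L-lipschitz_on Y P"
    and PS: "\<And>e. e \<in> Y \<Longrightarrow> P e \<in> S"
    and Q: "\<And>e. e \<in> Y \<Longrightarrow> quadratic_minorant f S (- lam) (P e) (e - lam *\<^sub>R (P e - a))"
    and e: "e \<in> Y" and T: "\<And>x. x \<in> T \<Longrightarrow> x \<in> S \<and> e + (1 / L) *\<^sub>R (x - P e) \<in> Y"
  shows "quadratic_minorant f T (1 / L - lam) (P e) (e - lam *\<^sub>R (P e - a))"
proof -
  have dom: "P e \<in> effective_domain f" if "e \<in> Y" for e
    using Q[OF that] by (simp add: quadratic_minorant_def)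
  then have "\<exists>\<phi>. f (P e) = ereal \<phi>" if "e \<in> Y" for e
    using proper_fun_real_value[OF proper] that by metis
  then obtain \<phi> where \<phi>: "\<And>e. e \<in> Y \<Longrightarrow> f (P e) = ereal (\<phi> e)"
    by metis
  define h where "h e = \<phi> e + lam / 2 * (norm (P e - a))\<^sup>2 - e \<bullet> (P e - a)" for e
  have below: "h e + e \<bullet> (x - a) \<le> b + lam / 2 * (norm (x - a))\<^sup>2"
    if "e \<in> Y" "x \<in> S" "f x = ereal b" for e x b
  proof -
    have "\<phi> e + (e - lam *\<^sub>R (P e - a)) \<bullet> (x - P e) + (- lam) / 2 * (norm (x - P e))\<^sup>2 \<le> b"
      using quadratic_minorant_real[OF proper Q[OF that(1)] that(2) \<phi>[OF that(1)] that(3)] .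
    then show ?thesis
      unfolding h_def power2_norm_eq_inner
      by (simp add: inner_simps inner_commute algebra_simps)
  qed
  have sup: "h v \<le> h w + (w - v) \<bullet> (P w - a)" if "v \<in> Y" "w \<in> Y" for v w
    using below[OF that(1) PS[OF that(2)] \<phi>[OF that(2)]]
    by (simp add: h_def inner_simps algebra_simps)
  have lip': "L-lipschitz_on Y (\<lambda>e. P e - a)"
    using lip by (simp add: lipschitz_on_def dist_norm)
  have "f (P e) + ereal ((e - lam *\<^sub>R (P e - a)) \<bullet> (x - P e) + (1 / L - lam) / 2 * (norm (x - P e))\<^sup>2) \<le> f x"
    if x: "x \<in> T" for x
  proof (cases "f x")
    case (real b)
    \<comment> \<open>This \<open>w\<close> maximizes \<open>(w - e) \<bullet> (x - P e) - L / 2 * (norm (w - e))\<^sup>2\<close>.\<close>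
    define w where "w = e + (1 / L) *\<^sub>R (x - P e)"
    have wY: "w \<in> Y" and xS: "x \<in> S" using T[OF x] by (auto simp: w_def)
    have "h e - (w - e) \<bullet> (P e - a) - L / 2 * (norm (w - e))\<^sup>2 \<le> h w"
      by (rule support_quadratic_bound[OF Y lip' sup e wY])
    also have "h w \<le> b + lam / 2 * (norm (x - a))\<^sup>2 - w \<bullet> (x - a)"
      using below[OF wY xS real] by simp
    finally have *: "h e - (w - e) \<bullet> (P e - a) - L / 2 * (norm (w - e))\<^sup>2 \<le> b + lam / 2 * (norm (x - a))\<^sup>2 - w \<bullet> (x - a)" .
    have we: "w - e = (1 / L) *\<^sub>R (x - P e)" by (simp add: w_def)
    have "L / 2 * (norm (w - e))\<^sup>2 = 1 / (2 * L) * (norm (x - P e))\<^sup>2"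
      unfolding we using L by (simp add: power2_eq_square)
    moreover have "w \<bullet> (x - a) = e \<bullet> (x - a) + (w - e) \<bullet> (x - P e) + (w - e) \<bullet> (P e - a)"
      by (simp add: inner_simps)
    moreover have "(w - e) \<bullet> (x - P e) = 1 / L * (norm (x - P e))\<^sup>2"
      unfolding we by (simp add: power2_norm_eq_inner)
    ultimately have "h e + e \<bullet> (x - a) + 1 / (2 * L) * (norm (x - P e))\<^sup>2 \<le> b + lam / 2 * (norm (x - a))\<^sup>2"
      using * by (simp add: algebra_simps)
    moreover have "(norm (x - a))\<^sup>2 = (norm (x - P e))\<^sup>2 + 2 * ((P e - a) \<bullet> (x - P e)) + (norm (P e - a))\<^sup>2"
      by (simp add: power2_norm_eq_inner inner_simps inner_commute)
    ultimately have "\<phi> e + (e - lam *\<^sub>R (P e - a)) \<bullet> (x - P e) + (1 / L - lam) / 2 * (norm (x - P e))\<^sup>2 \<le> b"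
      unfolding h_def by (simp add: inner_simps algebra_simps diff_divide_distrib)
    then show ?thesis
      by (simp add: real \<phi>[OF e])
  next
    case PInf
    then show ?thesis by simp
  next
    case MInf
    then show ?thesis using proper by (simp add: proper_fun_def)
  qed
  then show ?thesis
    using dom[OF e] by (simp add: quadratic_minorant_def)
qed

section \<open>Existence of resolvent points\<close>
lemma lsc_add_continuous_nbhd:
  fixes f :: "'a::t2_space \<Rightarrow> ereal" and q :: "'a \<Rightarrow> real"
  assumes lsc: "lower_semicontinuous f" and q: "isCont q x" and y: "y < f x + ereal (q x)"
  shows "\<forall>\<^sub>F z in nhds x. y < f z + ereal (q z)"
proof -
  have "y - ereal (q x) < f x"
    using y by (cases "f x"; cases y) auto
  then obtain t where t: "y - ereal (q x) < t" "t < f x"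
    using dense by blast
  obtain s where s: "t = ereal s"
    using t by (cases t) auto
  have "\<forall>\<^sub>F z in at x. t < f z"
    using lsc t(2) le_Liminf_iff[of "f x" "at x" f] unfolding lower_semicontinuous_def by blast
  then have f: "\<forall>\<^sub>F z in nhds x. t < f z"
    using t(2) by (simp add: eventually_nhds_conv_at)
  have "((\<lambda>z. ereal (s + q z)) \<longlongrightarrow> ereal (s + q x)) (nhds x)"
    using q by (intro tendsto_intros) (simp add: continuous_at tendsto_nhds_iff)
  moreover have "y < ereal (s + q x)"
    using t(1) s by (cases y) auto
  ultimately have "\<forall>\<^sub>F z in nhds x. y < ereal (s + q z)"
    by (rule order_tendstoD)
  with f show ?thesis
  proof eventually_elim
    case (elim z)
    have "ereal (s + q z) \<le> f z + ereal (q z)"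
      using elim(1) s by (cases "f z") auto
    with elim(2) show ?case by (rule less_le_trans)
  qed
qed

text \<open>
  If no point were a minimizer, each \<open>u\<close> would have a better point \<open>b u\<close>, and by lower
  semicontinuity \<open>b u\<close> is better than a whole neighborhood of \<open>u\<close>. Of the finitely many points
  \<open>b u\<close> belonging to a subcover, the best one lies in some neighborhood, which is absurd.
\<close>
lemma lsc_attains_minimum:
  fixes f :: "'a::t2_space \<Rightarrow> ereal" and q :: "'a \<Rightarrow> real"
  assumes lsc: "lower_semicontinuous f" and q: "\<And>x. isCont q x"
    and S: "compact S" "S \<noteq> {}"
  obtains u where "u \<in> S" "\<And>x. x \<in> S \<Longrightarrow> f u + ereal (q u) \<le> f x + ereal (q x)"
proof (rule ccontr)
  define h where "h x = f x + ereal (q x)" for x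
  assume "\<not> thesis"
  with that have "\<forall>u\<in>S. \<exists>x\<in>S. h x < h u"
    unfolding h_def by (meson not_le)
  then obtain b where b: "\<And>u. u \<in> S \<Longrightarrow> b u \<in> S \<and> h (b u) < h u"
    by metis
  have "\<exists>U. open U \<and> u \<in> U \<and> (\<forall>z\<in>U. h (b u) < h z)" if "u \<in> S" for u
    using lsc_add_continuous_nbhd[OF lsc q, of "h (b u)" u] b[OF that]
    by (simp add: h_def eventually_nhds)
  then obtain U where U: "\<And>u. u \<in> S \<Longrightarrow> open (U u) \<and> u \<in> U u \<and> (\<forall>z\<in>U u. h (b u) < h z)"
    by metis
  obtain C where C: "C \<subseteq> S" "finite C" "S \<subseteq> (\<Union>u\<in>C. U u)"
    using compactE_image[OF S(1), of S U] U by blast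
  have "C \<noteq> {}" using C(3) S(2) by auto
  then obtain c where c: "c \<in> C" "\<And>u. u \<in> C \<Longrightarrow> h (b c) \<le> h (b u)"
    using C(2) arg_min_if_finite[of C "\<lambda>u. h (b u)"] by (meson not_le)
  then have "b c \<in> S" using C(1) b by blast
  then obtain u where "u \<in> C" "b c \<in> U u" using C(3) by blast
  then have "h (b u) < h (b c)" using U C(1) by blast
  with c(2)[OF \<open>u \<in> C\<close>] show False by simp
qed

text \<open>
  The point \<open>u\<close> minimizes \<open>f x + lam / 2 * (norm (x - a))\<^sup>2 - e \<bullet> (x - a)\<close> on the ball. Since
  \<open>c + lam > 0\<close>, the function without the linear term grows quadratically away from \<open>a\<close>, so \<open>u\<close> is
  close to \<open>a\<close> for small \<open>e\<close> and, in particular, interior to the ball. It is used with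
  \<open>c = - r\<close>, \<open>lam > r\<close> for the resolvent of the subdifferential, and with \<open>c = 1 / \<kappa>\<close>,
  \<open>lam = 0\<close> for tilted minimizers.
\<close>
lemma exists_resolvent_point:
  fixes f :: "'a::euclidean_space \<Rightarrow> ereal"
  assumes lsc: "lower_semicontinuous f" and proper: "proper_fun f"
    and Q: "quadratic_minorant f (cball a \<delta>) c a 0" and \<delta>: "0 \<le> \<delta>" and pos: "0 < c + lam"
  obtains u where "u \<in> cball a \<delta>" "norm (u - a) \<le> 2 / (c + lam) * norm e"
    "quadratic_minorant f (cball a \<delta>) (- lam) u (e - lam *\<^sub>R (u - a))"
proof -
  define q where "q x = lam / 2 * (norm (x - a))\<^sup>2 - e \<bullet> (x - a)" for x
  obtain u where u: "u \<in> cball a \<delta>"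
    and min: "\<And>x. x \<in> cball a \<delta> \<Longrightarrow> f u + ereal (q u) \<le> f x + ereal (q x)"
  proof (rule lsc_attains_minimum[OF lsc, of q "cball a \<delta>"])
    show "isCont q x" for x
      unfolding q_def by (intro continuous_intros)
  qed (use \<delta> in auto)
  have a: "a \<in> effective_domain f" "a \<in> cball a \<delta>"
    using Q \<delta> by (auto simp: quadratic_minorant_def)
  obtain \<alpha> where \<alpha>: "f a = ereal \<alpha>"
    using proper_fun_real_value[OF proper a(1)] .
  have "f u < \<infinity>"
    using min[OF a(2)] \<alpha> by (cases "f u") auto
  then have dom: "u \<in> effective_domain f"
    by (simp add: effective_domain_def)
  obtain \<beta> where \<beta>: "f u = ereal \<beta>"
    using proper_fun_real_value[OF proper dom] .
  have Qu: "quadratic_minorant f (cball a \<delta>) (- lam) u (e - lam *\<^sub>R (u - a))"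
    unfolding quadratic_minorant_def
  proof (intro conjI dom ballI)
    fix x assume x: "x \<in> cball a \<delta>"
    have "(e - lam *\<^sub>R (u - a)) \<bullet> (x - u) + - lam / 2 * (norm (x - u))\<^sup>2 = q u - q x"
      unfolding q_def power2_norm_eq_inner by (simp add: inner_simps inner_commute algebra_simps)
    then show "f u + ereal ((e - lam *\<^sub>R (u - a)) \<bullet> (x - u) + - lam / 2 * (norm (x - u))\<^sup>2) \<le> f x"
      using min[OF x] \<beta> by (cases "f x") auto
  qed
  have "\<alpha> + c / 2 * (norm (u - a))\<^sup>2 \<le> \<beta>"
    using quadratic_minorant_real[OF proper Q u \<alpha> \<beta>] by simp
  moreover have "\<beta> + q u \<le> \<alpha>"
    using min[OF a(2)] by (simp add: \<alpha> \<beta> q_def)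
  ultimately have "(c + lam) / 2 * (norm (u - a))\<^sup>2 \<le> e \<bullet> (u - a)"
    by (simp add: q_def field_simps)
  also have "\<dots> \<le> norm e * norm (u - a)"
    by (rule norm_cauchy_schwarz)
  finally have "((c + lam) / 2 * norm (u - a)) * norm (u - a) \<le> norm e * norm (u - a)"
    by (simp add: power2_eq_square mult.assoc)
  then have "(c + lam) / 2 * norm (u - a) \<le> norm e"
    by (cases "norm (u - a) = 0") (auto simp: mult_le_cancel_right)
  then have "norm (u - a) \<le> 2 / (c + lam) * norm e"
    using pos by (simp add: field_simps)
  with u Qu that show ?thesis by blast
qed

section \<open>A mean value inequality for directional limits\<close>

text \<open>
  A Lipschitz map need not be differentiable, but its difference quotients have limit points,
  and bounding all of these suffices. On a segment, the largest \<open>s\<close> up to which the increment is at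
  most \<open>(L * norm d + \<epsilon>) * s\<close> must be \<open>1\<close>: otherwise all increments to the right of it are too large,
  and a limit point of the corresponding quotients violates the bound.
\<close>
lemma lipschitz_from_directional_limits:
  fixes P :: "'a::real_normed_vector \<Rightarrow> 'b::euclidean_space"
  assumes Y: "convex Y" and lip: "K-lipschitz_on Y P" and L: "0 \<le> L"
    and bound: "\<And>y d t w. \<lbrakk>y \<in> Y; \<And>k. 0 < t k; t \<longlonglongrightarrow> 0; \<And>k. y + t k *\<^sub>R d \<in> Y;
        (\<lambda>k::nat. (1 / t k) *\<^sub>R (P (y + t k *\<^sub>R d) - P y)) \<longlonglongrightarrow> w\<rbrakk> \<Longrightarrow> norm w \<le> L * norm d"
  shows "L-lipschitz_on Y P"
proof (rule lipschitz_onI[OF _ L])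
  fix y x assume yx: "y \<in> Y" "x \<in> Y"
  define d where "d = x - y"
  define p where "p s = P (y + s *\<^sub>R d)" for s :: real
  have inY: "y + s *\<^sub>R d \<in> Y" if "s \<in> {0..1}" for s
  proof -
    have "y + s *\<^sub>R d = (1 - s) *\<^sub>R y + s *\<^sub>R x"
      by (simp add: d_def algebra_simps)
    then show ?thesis
      using convexD[OF Y yx, of "1 - s" s] that by simp
  qed
  have plip: "norm (p s - p s') \<le> K * norm d * \<bar>s - s'\<bar>" if "s \<in> {0..1}" "s' \<in> {0..1}" for s s'
    using lipschitz_onD[OF lip inY[OF that(1)] inY[OF that(2)]]
    by (simp add: p_def dist_norm mult_ac flip: scaleR_left_diff_distrib)
  have K: "0 \<le> K" using lip by (rule lipschitz_on_nonneg)
  have cont: "continuous_on {0..1} p"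
  proof (rule lipschitz_on_continuous_on)
    show "(K * norm d)-lipschitz_on {0..1} p"
      using plip K by (intro lipschitz_onI) (auto simp: dist_norm dist_real_def)
  qed
  have "norm (p 1 - p 0) \<le> L * norm d + \<epsilon>" if \<epsilon>: "0 < \<epsilon>" for \<epsilon>
  proof -
    define C where "C = L * norm d + \<epsilon>"
    define A where "A = {s \<in> {0..1}. norm (p s - p 0) - C * s \<le> 0}"
    have "closed A"
      unfolding A_def
      by (intro continuous_on_closed_Collect_le continuous_intros cont)
    moreover have "A \<noteq> {}" "bdd_above A"
      by (auto simp: A_def intro!: exI[of _ 0])
    ultimately have sup: "Sup A \<in> A"
      by (intro closed_contains_Sup)
    define \<sigma> where "\<sigma> = Sup A"
    have \<sigma>: "\<sigma> \<in> {0..1}" "norm (p \<sigma> - p 0) \<le> C * \<sigma>"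
      using sup by (auto simp: A_def \<sigma>_def)
    have "\<sigma> = 1"
    proof (rule ccontr)
      assume "\<sigma> \<noteq> 1"
      with \<sigma>(1) have lt: "\<sigma> < 1" by simp
      have fail: "C * t < norm (p (\<sigma> + t) - p \<sigma>)" if "0 < t" "t \<le> 1 - \<sigma>" for t
      proof (rule ccontr)
        assume "\<not> ?thesis"
        then have "norm (p (\<sigma> + t) - p 0) \<le> C * t + C * \<sigma>"
          using \<sigma>(2) norm_triangle_ineq[of "p (\<sigma> + t) - p \<sigma>" "p \<sigma> - p 0"] by simp
        then have "\<sigma> + t \<in> A"
          using that \<sigma>(1) by (simp add: A_def algebra_simps)
        then have "\<sigma> + t \<le> \<sigma>"
          unfolding \<sigma>_def using \<open>bdd_above A\<close> by (rule cSup_upper)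
        with that show False by simp
      qed
      define t where "t k = (1 - \<sigma>) / real (Suc k)" for k
      have t: "0 < t k" "t k \<le> 1 - \<sigma>" for k
        using lt \<sigma>(1) by (auto simp: t_def field_simps intro: mult_left_le_one_le)
      have t0: "t \<longlonglongrightarrow> 0"
      proof -
        have "(\<lambda>k. (1 - \<sigma>) * inverse (real (Suc k))) \<longlonglongrightarrow> (1 - \<sigma>) * 0"
          by (intro tendsto_intros LIMSEQ_inverse_real_of_nat)
        then show ?thesis by (simp add: t_def[abs_def] field_simps)
      qed
      define w where "w k = (1 / t k) *\<^sub>R (p (\<sigma> + t k) - p \<sigma>)" for k
      have in01: "\<sigma> + t k \<in> {0..1}" for k
        using t[of k] \<sigma>(1) by auto
      have wn: "norm (w k) = norm (p (\<sigma> + t k) - p \<sigma>) / t k" for k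
        using t(1)[of k] by (simp add: w_def)
      have wlow: "C \<le> norm (w k)" for k
        using fail[OF t, of k] t(1)[of k] by (simp add: wn field_simps)
      have "norm (w k) \<le> K * norm d" for k
        using plip[OF in01[of k] \<sigma>(1)] t(1)[of k] by (simp add: wn field_simps)
      then have "bounded (range w)"
        by (auto simp: bounded_iff)
      then obtain l r where r: "strict_mono r" and l: "(w \<circ> r) \<longlonglongrightarrow> l"
        using bounded_imp_convergent_subsequence by blast
      have "norm l \<le> L * norm d"
      proof (rule bound[of "y + \<sigma> *\<^sub>R d" "t \<circ> r"])
        show "(t \<circ> r) \<longlonglongrightarrow> 0"
          using t0 r by (rule LIMSEQ_subseq_LIMSEQ)
        show "y + \<sigma> *\<^sub>R d + (t \<circ> r) k *\<^sub>R d \<in> Y" for k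
          using inY[OF in01[of "r k"]] by (simp add: scaleR_left_distrib add.assoc)
        show "(\<lambda>k. (1 / (t \<circ> r) k) *\<^sub>R (P (y + \<sigma> *\<^sub>R d + (t \<circ> r) k *\<^sub>R d) - P (y + \<sigma> *\<^sub>R d))) \<longlonglongrightarrow> l"
          using l by (simp add: o_def w_def p_def scaleR_left_distrib add.assoc)
      qed (use t inY[OF \<sigma>(1)] in auto)
      moreover have "C \<le> norm l"
        using tendsto_norm[OF l] wlow by (intro tendsto_lowerbound) auto
      ultimately show False using \<epsilon> by (simp add: C_def)
    qed
    with \<sigma>(2) show ?thesis by (simp add: C_def)
  qed
  then have "norm (p 1 - p 0) \<le> L * norm d"
    by (rule field_le_epsilon)
  then show "dist (P y) (P x) \<le> L * dist y x"
    by (simp add: p_def d_def dist_norm norm_minus_commute)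
qed

section \<open>Localization of the subdifferential graph\<close>
lemma gph_subdifferential_iff:
  "(u, v) \<in> gph (subdifferential f) \<longleftrightarrow> v \<in> subdifferential f u"
  by (simp add: gph_def)

lemma subdifferential_imp_effective_domain:
  "v \<in> subdifferential f u \<Longrightarrow> u \<in> effective_domain f"
  by (auto simp: subdifferential_def split: if_splits)

text \<open>
  Prox-regularity is restricted to points \<open>u\<close> with \<open>f u\<close> close to \<open>f a\<close>. By subdifferential
  continuity this holds for all points of the graph near \<open>(a, vbar)\<close>.
\<close>
lemma prox_regular_uniform_minorant:
  fixes f :: "'a::real_inner \<Rightarrow> ereal"
  assumes proper: "proper_fun f"
    and prox: "prox_regular f a vbar" and sub: "subdifferentially_continuous f a vbar"
  obtains r \<delta> where "0 < r" "0 < \<delta>"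
    "\<And>u v. (u, v) \<in> gph (subdifferential f) \<Longrightarrow> (u, v) \<in> cball (a, vbar) \<delta> \<Longrightarrow>
       quadratic_minorant f (cball a \<delta>) (- r) u v"
proof -
  obtain r \<epsilon> where r: "0 < r" and \<epsilon>: "0 < \<epsilon>"
    and pr: "\<And>x u v. x \<in> cball a \<epsilon> \<Longrightarrow> u \<in> cball a \<epsilon> \<Longrightarrow> \<bar>f u - f a\<bar> < ereal \<epsilon> \<Longrightarrow>
        v \<in> subdifferential f u \<inter> cball vbar \<epsilon> \<Longrightarrow>
        f u + ereal (v \<bullet> (x - u) - r / 2 * (norm (x - u))\<^sup>2) \<le> f x"
    and stat: "vbar \<in> subdifferential f a"
    using prox unfolding prox_regular_def by blast
  obtain \<alpha> where \<alpha>: "f a = ereal \<alpha>"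
    using proper_fun_real_value[OF proper subdifferential_imp_effective_domain[OF stat]] .
  have "((\<lambda>(x, v). f x) \<longlongrightarrow> ereal \<alpha>) (at (a, vbar) within gph (subdifferential f))"
    using sub \<alpha> by (simp add: subdifferentially_continuous_def continuous_within)
  then have "\<forall>\<^sub>F p in at (a, vbar) within gph (subdifferential f).
      (case p of (x, v) \<Rightarrow> f x) \<in> {ereal (\<alpha> - \<epsilon>)<..<ereal (\<alpha> + \<epsilon>)}"
    using \<epsilon> by (intro topological_tendstoD) auto
  then obtain d where d: "0 < d"
    and close: "\<And>u v. (u, v) \<in> gph (subdifferential f) \<Longrightarrow> (u, v) \<noteq> (a, vbar) \<Longrightarrow>
      dist (u, v) (a, vbar) < d \<Longrightarrow> ereal (\<alpha> - \<epsilon>) < f u \<and> f u < ereal (\<alpha> + \<epsilon>)"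
    unfolding eventually_at by (metis (mono_tags, lifting) case_prod_conv greaterThanLessThan_iff)
  define \<delta> where "\<delta> = min \<epsilon> (d / 2)"
  have "quadratic_minorant f (cball a \<delta>) (- r) u v"
    if gph: "(u, v) \<in> gph (subdifferential f)" and near: "(u, v) \<in> cball (a, vbar) \<delta>" for u v
    unfolding quadratic_minorant_def
  proof (intro conjI ballI)
    show dom: "u \<in> effective_domain f"
      using gph by (auto simp: gph_subdifferential_iff dest: subdifferential_imp_effective_domain)
    fix x assume x: "x \<in> cball a \<delta>"
    obtain \<beta> where \<beta>: "f u = ereal \<beta>"
      using proper_fun_real_value[OF proper dom] .
    have "dist (u, v) (a, vbar) < d"
      using near d by (auto simp: \<delta>_def dist_commute)
    then have "\<bar>f u - f a\<bar> < ereal \<epsilon>"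
      using close[OF gph] \<alpha> \<beta> \<epsilon> by (cases "(u, v) = (a, vbar)") auto
    moreover have "dist a u \<le> \<delta>" "dist vbar v \<le> \<delta>"
      using near dist_fst_le[of "(a, vbar)" "(u, v)"] dist_snd_le[of "(a, vbar)" "(u, v)"] by auto
    ultimately show "f u + ereal (v \<bullet> (x - u) + - r / 2 * (norm (x - u))\<^sup>2) \<le> f x"
      using pr[of x u v] x gph by (auto simp: \<delta>_def gph_subdifferential_iff)
  qed
  moreover have "0 < \<delta>" using \<epsilon> d by (simp add: \<delta>_def)
  ultimately show ?thesis using that r by blast
qed

text \<open>
  The condition that mediates between tilt stability and the graphical derivative.
\<close>
definition uniform_quadratic_growth :: "('a::real_inner \<Rightarrow> ereal) \<Rightarrow> 'a \<Rightarrow> real \<Rightarrow> bool" where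
  "uniform_quadratic_growth f a c \<longleftrightarrow>
     (\<exists>\<delta>>0. \<forall>u v. (u, v) \<in> gph (subdifferential f) \<inter> cball (a, 0) \<delta> \<longrightarrow>
        quadratic_minorant f (cball a \<delta>) c u v)"

definition graphical_derivative_bound :: "('a::real_inner \<Rightarrow> ereal) \<Rightarrow> 'a \<Rightarrow> real \<Rightarrow> real \<Rightarrow> bool" where
  "graphical_derivative_bound f a c \<eta> \<longleftrightarrow>
     (\<forall>w z u v. (u, v) \<in> gph (subdifferential f) \<inter> cball (a, 0) \<eta> \<longrightarrow>
        z \<in> subgradient_graphical_derivative f u v w \<longrightarrow> z \<bullet> w \<ge> c * (norm w)\<^sup>2)"

lemma mem_cball_Pair:
  fixes a u :: "'a::real_normed_vector" and b v :: "'b::real_normed_vector"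
  assumes "norm (u - a) \<le> d / 2" "norm (v - b) \<le> d / 2"
  shows "(u, v) \<in> cball (a, b) d"
proof -
  have "dist (a, b) (u, v) \<le> norm (a - u) + norm (b - v)"
    by (simp add: dist_norm norm_Pair_le)
  then show ?thesis
    using assms by (simp add: norm_minus_commute)
qed

lemma mem_cball_PairD:
  assumes "(u, v) \<in> cball (a, b) d"
  shows "norm (u - a) \<le> d" "norm (v - b) \<le> d"
  using assms dist_fst_le[of "(a, b)" "(u, v)"] dist_snd_le[of "(a, b)" "(u, v)"]
  by (auto simp: dist_norm norm_minus_commute)

text \<open>
  On the localized graph, \<open>(u, v) \<mapsto> v + lam (u - a)\<close> is injective as soon as \<open>lam\<close> exceeds the
  prox-regularity constant, because the shifted subdifferential is strongly monotone. Two
  parametrizations of pieces of the graph can therefore be compared through this single parameter.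
\<close>
lemma resolvent_unique:
  fixes f :: "'a::real_inner \<Rightarrow> ereal"
  assumes proper: "proper_fun f"
    and Q: "quadratic_minorant f S (- r) u v" "quadratic_minorant f S (- r) u' v'"
    and S: "u \<in> S" "u' \<in> S" and r: "r < lam"
    and eq: "v + lam *\<^sub>R (u - a) = v' + lam *\<^sub>R (u' - a)"
  shows "u = u'" "v = v'"
proof -
  have v: "v - v' = - lam *\<^sub>R (u - u')"
    using eq by (simp add: algebra_simps)
  have "(- r + - r) / 2 * (norm (u - u'))\<^sup>2 \<le> (v - v') \<bullet> (u - u')"
    using quadratic_minorant_monotone[OF proper Q S] .
  then have "(lam - r) * (norm (u - u'))\<^sup>2 \<le> 0"
    by (simp add: v power2_norm_eq_inner algebra_simps)
  then show "u = u'"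
    using r by (simp add: mult_le_0_iff)
  with v show "v = v'" by simp
qed

lemma tilt_argmin_minorant:
  fixes f :: "'a::real_inner \<Rightarrow> ereal"
  assumes proper: "proper_fun f" and dom: "a \<in> effective_domain f" and \<gamma>: "0 \<le> \<gamma>"
  shows "u \<in> tilt_argmin f a \<gamma> v \<longleftrightarrow> u \<in> cball a \<gamma> \<and> quadratic_minorant f (cball a \<gamma>) 0 u v"
proof -
  obtain \<alpha> where \<alpha>: "f a = ereal \<alpha>"
    using proper_fun_real_value[OF proper dom] .
  have fin: "u \<in> effective_domain f" if "f u - ereal (v \<bullet> u) \<le> f a - ereal (v \<bullet> a)"
    using that \<alpha> by (cases "f u") (auto simp: effective_domain_def)
  have iff: "f u - ereal (v \<bullet> u) \<le> f x - ereal (v \<bullet> x) \<longleftrightarrow> f u + ereal (v \<bullet> (x - u)) \<le> f x"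
    if udom: "u \<in> effective_domain f" for x
  proof -
    obtain \<beta> where \<beta>: "f u = ereal \<beta>"
      using proper_fun_real_value[OF proper udom] .
    show ?thesis by (cases "f x") (auto simp: \<beta> inner_diff_right)
  qed
  have "a \<in> cball a \<gamma>" using \<gamma> by simp
  then show ?thesis
    using fin iff unfolding tilt_argmin_def is_arg_min_def quadratic_minorant_def not_ex mem_Collect_eq
    by (auto simp: not_less)
qed

section \<open>From tilt stability to growth\<close>

text \<open>
  The equation says that \<open>v\<close> is a fixed point of \<open>F v = e - lam (m v - m 0)\<close>. Brouwer's theorem
  gives a fixed point of \<open>F\<close> followed by the projection onto the ball; the characterization of
  projections and monotonicity then show \<open>norm v \<le> norm e\<close>, so \<open>v\<close> is interior and the
  projection did nothing.
\<close>
lemma surjective_perturbed_monotone: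
  fixes m :: "'a::euclidean_space \<Rightarrow> 'a"
  assumes cont: "continuous_on (cball 0 \<rho>) m" and e: "norm e < \<rho>" and lam: "0 \<le> lam"
    and mono: "\<And>v. v \<in> cball 0 \<rho> \<Longrightarrow> 0 \<le> (m v - m 0) \<bullet> v"
  obtains v where "norm v \<le> norm e" "v + lam *\<^sub>R (m v - m 0) = e"
proof -
  have \<rho>: "0 < \<rho>" using e norm_ge_zero[of e] by linarith
  define B where "B = cball (0::'a) \<rho>"
  have B: "convex B" "closed B" "compact B" "B \<noteq> {}" using \<rho> by (auto simp: B_def)
  define F where "F v = e - lam *\<^sub>R (m v - m 0)" for v
  have "continuous_on B F"
    unfolding F_def B_def by (intro continuous_intros cont)
  then have "continuous_on B (\<lambda>v. closest_point B (F v))"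
    using continuous_on_closest_point[OF B(1,2,4), of UNIV]
    by (intro continuous_on_compose2[where s = B and f = F and g = "closest_point B"]) auto
  then obtain v where v: "v \<in> B" "closest_point B (F v) = v"
    using brouwer[OF B(3,1,4), of "\<lambda>v. closest_point B (F v)"] closest_point_in_set[OF B(2,4)] by auto
  have var: "(F v - v) \<bullet> (y - v) \<le> 0" if "y \<in> B" for y
    using closest_point_dot[OF B(1,2) that, of "F v"] v(2) by simp
  have "v \<bullet> v \<le> F v \<bullet> v"
    using var[of 0] \<rho> by (simp add: B_def inner_simps)
  also have "\<dots> \<le> e \<bullet> v"
    using mono[of v] v(1) lam by (simp add: F_def B_def inner_diff_left)
  also have "\<dots> \<le> norm e * norm v"
    by (rule norm_cauchy_schwarz)
  finally have "norm v * norm v \<le> norm e * norm v"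
    by (simp add: power2_norm_eq_inner[symmetric] power2_eq_square)
  then have nv: "norm v \<le> norm e"
    by (cases "v = 0") (auto simp: mult_le_cancel_right)
  have "F v = v"
  proof (rule ccontr)
    assume ne: "F v \<noteq> v"
    \<comment> \<open>The largest step towards \<open>F v\<close> that the triangle inequality keeps inside the ball.\<close>
    define t where "t = (\<rho> - norm v) / norm (F v - v)"
    have t: "0 < t" using ne nv e by (simp add: t_def)
    have "norm (v + t *\<^sub>R (F v - v)) \<le> norm v + t * norm (F v - v)"
      using norm_triangle_ineq[of v "t *\<^sub>R (F v - v)"] t by simp
    also have "\<dots> = \<rho>" using ne by (simp add: t_def)
    finally have "v + t *\<^sub>R (F v - v) \<in> B" by (simp add: B_def)
    then have "t * ((F v - v) \<bullet> (F v - v)) \<le> 0" using var by fastforce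
    moreover have "0 < t * ((F v - v) \<bullet> (F v - v))" using t ne by simp
    ultimately show False by linarith
  qed
  then have "v + lam *\<^sub>R (m v - m 0) = e"
    by (metis F_def diff_add_cancel)
  with nv that show ?thesis by blast
qed

text \<open>
  The growth inequality is available at \<open>(m v', v')\<close> with \<open>m\<close> the argmin mapping. For a given point
  \<open>(u, v)\<close> of the graph, \<open>v'\<close> is chosen with the same parameter \<open>v' + lam (m v' - a) = v + lam (u - a)\<close>,
  and uniqueness of resolvents identifies the two points. The comparison is needed because
  stationarity of \<open>u\<close> for the tilted function does not by itself imply minimality.
\<close>
lemma tilt_stable_imp_growth:
  fixes f :: "'a::euclidean_space \<Rightarrow> ereal"
  assumes proper: "proper_fun f"
    and prox: "prox_regular f a 0" and sub: "subdifferentially_continuous f a 0"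
    and tilt: "tilt_stable_local_minimizer f a \<kappa>"
  shows "uniform_quadratic_growth f a (1 / \<kappa>)"
proof -
  have \<kappa>: "0 < \<kappa>" and dom: "a \<in> effective_domain f"
    using tilt by (auto simp: tilt_stable_local_minimizer_def)
  obtain \<gamma> V m where \<gamma>: "0 < \<gamma>" and V: "open V" "0 \<in> V"
    and argmin: "\<And>v. v \<in> V \<Longrightarrow> tilt_argmin f a \<gamma> v = {m v}"
    and lipV: "\<kappa>-lipschitz_on V m" and m0: "m 0 = a"
    using tilt unfolding tilt_stable_local_minimizer_def by blast
  obtain r \<delta>0 where r: "0 < r" and \<delta>0: "0 < \<delta>0"
    and loc: "\<And>u v. (u, v) \<in> gph (subdifferential f) \<Longrightarrow> (u, v) \<in> cball (a, 0) \<delta>0 \<Longrightarrow>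
       quadratic_minorant f (cball a \<delta>0) (- r) u v"
    using prox_regular_uniform_minorant[OF proper prox sub] by blast
  obtain \<rho> where \<rho>: "0 < \<rho>" and Y: "ball 0 \<rho> \<subseteq> V"
    using V open_contains_ball by metis
  define lam where "lam = r + 1"
  have lip: "\<kappa>-lipschitz_on (ball 0 \<rho>) m"
    using lipV Y by (rule lipschitz_on_subset)
  have mQ: "m v \<in> cball a \<gamma>" "quadratic_minorant f (cball a \<gamma>) 0 (m v) v" if "v \<in> ball 0 \<rho>" for v
    using argmin[of v] that Y tilt_argmin_minorant[OF proper dom, of \<gamma> "m v" v] \<gamma> by auto
  have ma: "norm (m v - a) \<le> \<kappa> * norm v" if "v \<in> ball 0 \<rho>" for v
    using lipschitz_onD[OF lip that, of 0] \<rho> by (simp add: m0 dist_norm)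
  \<comment> \<open>For \<open>norm v \<le> \<tau>\<close> the point \<open>m v\<close> is inside both balls, so that it is stationary for the
    tilted function and prox-regularity applies.\<close>
  define \<tau> where "\<tau> = Min {\<rho> / 4, \<delta>0 / 2, \<delta>0 / (2 * \<kappa>), \<gamma> / (2 * \<kappa>)}"
  have \<tau>: "0 < \<tau>" "\<tau> \<le> \<rho> / 4" "\<tau> \<le> \<delta>0 / 2" "\<kappa> * \<tau> \<le> \<delta>0 / 2" "\<kappa> * \<tau> \<le> \<gamma> / 2"
  proof -
    have "\<tau> \<le> \<delta>0 / (2 * \<kappa>)" "\<tau> \<le> \<gamma> / (2 * \<kappa>)" by (auto simp: \<tau>_def)
    then show "\<kappa> * \<tau> \<le> \<delta>0 / 2" "\<kappa> * \<tau> \<le> \<gamma> / 2" using \<kappa> by (auto simp: field_simps)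
  qed (use \<rho> \<delta>0 \<kappa> \<gamma> in \<open>auto simp: \<tau>_def\<close>)
  define \<delta> where "\<delta> = Min {\<gamma>, \<delta>0, \<kappa> * \<rho> / 4, \<tau> / (1 + lam)}"
  have \<delta>: "0 < \<delta>" "\<delta> \<le> \<gamma>" "\<delta> \<le> \<delta>0" "\<delta> \<le> \<kappa> * \<rho> / 4" "\<delta> \<le> \<tau> / (1 + lam)"
  proof -
    show "0 < \<delta>" using \<gamma> \<delta>0 \<kappa> \<rho> \<tau>(1) r by (auto simp: \<delta>_def lam_def)
  qed (unfold \<delta>_def, (rule Min_le; simp)+)
  have "quadratic_minorant f (cball a \<delta>) (1 / \<kappa>) u v"
    if gph: "(u, v) \<in> gph (subdifferential f)" and near: "(u, v) \<in> cball (a, 0) \<delta>" for u v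
  proof -
    have uv: "norm (u - a) \<le> \<delta>" "norm v \<le> \<delta>"
      using mem_cball_PairD[OF near] by auto
    define e where "e = v + lam *\<^sub>R (u - a)"
    have "norm e \<le> norm v + lam * norm (u - a)"
      using norm_triangle_ineq[of v "lam *\<^sub>R (u - a)"] r by (simp add: e_def lam_def)
    also have "\<dots> \<le> \<delta> + lam * \<delta>"
      using uv r by (intro add_mono mult_left_mono) (auto simp: lam_def)
    also have "\<dots> \<le> \<tau>"
      using \<delta>(5) r by (simp add: lam_def field_simps)
    finally have e\<tau>: "norm e \<le> \<tau>" .
    obtain v' where v': "norm v' \<le> norm e" "v' + lam *\<^sub>R (m v' - m 0) = e"
    proof (rule surjective_perturbed_monotone[of "\<rho> / 2" m e lam])
      show "continuous_on (cball 0 (\<rho> / 2)) m"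
        using \<rho> lipschitz_on_continuous_on[OF lip] by (rule_tac continuous_on_subset) auto
      show "0 \<le> (m w - m 0) \<bullet> w" if "w \<in> cball 0 (\<rho> / 2)" for w
        using quadratic_minorant_monotone[OF proper mQ(2) mQ(2) mQ(1) mQ(1), of w 0] that \<rho>
        by (simp add: inner_commute)
    qed (use e\<tau> \<tau> \<rho> r in \<open>auto simp: lam_def\<close>)
    have v'Y: "v' \<in> ball 0 \<rho>" using v'(1) e\<tau> \<tau>(2) \<rho> by simp
    have "\<kappa> * norm v' \<le> \<kappa> * \<tau>"
      using v'(1) e\<tau> \<kappa> by (intro mult_left_mono) auto
    with ma[OF v'Y] have mv: "norm (m v' - a) \<le> \<kappa> * \<tau>" by simp
    have "m v' \<in> interior (cball a \<gamma>)"
      using mv \<tau>(5) \<gamma> by (simp add: interior_cball dist_norm norm_minus_commute)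
    then have gph': "(m v', v') \<in> gph (subdifferential f)"
      using quadratic_minorant_imp_subgradient[OF proper mQ(2)[OF v'Y]]
      by (simp add: gph_subdifferential_iff)
    have near': "(m v', v') \<in> cball (a, 0) \<delta>0"
      using mv v'(1) e\<tau> \<tau> by (intro mem_cball_Pair) auto
    have near0: "(u, v) \<in> cball (a, 0) \<delta>0"
      using near \<delta>(3) by auto
    have "u = m v'" "v = v'"
    proof -
      have in0: "u \<in> cball a \<delta>0" "m v' \<in> cball a \<delta>0"
        using mem_cball_PairD(1)[OF near0] mem_cball_PairD(1)[OF near']
        by (auto simp: dist_norm norm_minus_commute)
      have eq: "v + lam *\<^sub>R (u - a) = v' + lam *\<^sub>R (m v' - a)"
        using v'(2) by (simp add: e_def m0)
      show "u = m v'" "v = v'"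
        using resolvent_unique[OF proper loc[OF gph near0] loc[OF gph' near'] in0 _ eq]
        by (auto simp: lam_def)
    qed
    moreover have "quadratic_minorant f (cball a \<delta>) (1 / \<kappa> - 0) (m v') (v' - 0 *\<^sub>R (m v' - a))"
    proof (rule lipschitz_resolvent_growth[OF proper _ \<kappa> lip])
      fix x assume x: "x \<in> cball a \<delta>"
      have "norm (x - m v') \<le> norm (x - a) + norm (m v' - a)"
        using norm_triangle_ineq4[of "x - a" "m v' - a"] by simp
      also have "\<dots> \<le> \<kappa> * \<rho> / 4 + \<kappa> * norm v'"
        using x ma[OF v'Y] \<delta>(4) by (intro add_mono) (auto simp: dist_norm norm_minus_commute)
      finally have "norm (x - m v') / \<kappa> \<le> \<rho> / 4 + norm v'"
        using \<kappa> by (simp add: field_simps)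
      moreover have "norm (v' + (1 / \<kappa>) *\<^sub>R (x - m v')) \<le> norm v' + norm (x - m v') / \<kappa>"
        using norm_triangle_ineq[of v' "(1 / \<kappa>) *\<^sub>R (x - m v')"] \<kappa> by simp
      ultimately have "norm (v' + (1 / \<kappa>) *\<^sub>R (x - m v')) < \<rho>"
        using v'(1) e\<tau> \<tau>(2) \<rho> by linarith
      then show "x \<in> cball a \<gamma> \<and> v' + (1 / \<kappa>) *\<^sub>R (x - m v') \<in> ball 0 \<rho>"
        using x \<delta>(2) by simp
    qed (use mQ v'Y in auto)
    ultimately show ?thesis by simp
  qed
  with \<delta>(1) show ?thesis
    unfolding uniform_quadratic_growth_def by blast
qed

section \<open>From growth to tilt stability\<close>

text \<open>
  Growth at \<open>(a, 0)\<close> gives minimizers of the tilted functions; these are stationary, hence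
  enjoy growth themselves, which makes them unique. The monotonicity inequality with constant
  \<open>1 / \<kappa>\<close> and Cauchy-Schwarz give the Lipschitz constant \<open>\<kappa>\<close>.
\<close>
lemma growth_imp_tilt_stable:
  fixes f :: "'a::euclidean_space \<Rightarrow> ereal"
  assumes lsc: "lower_semicontinuous f" and proper: "proper_fun f"
    and stat: "0 \<in> subdifferential f a" and \<kappa>: "0 < \<kappa>"
    and growth: "uniform_quadratic_growth f a (1 / \<kappa>)"
  shows "tilt_stable_local_minimizer f a \<kappa>"
proof -
  obtain \<delta> where \<delta>: "0 < \<delta>"
    and Q: "\<And>u v. (u, v) \<in> gph (subdifferential f) \<Longrightarrow> (u, v) \<in> cball (a, 0) \<delta> \<Longrightarrow>
        quadratic_minorant f (cball a \<delta>) (1 / \<kappa>) u v"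
    using growth unfolding uniform_quadratic_growth_def by blast
  have dom: "a \<in> effective_domain f"
    using stat by (rule subdifferential_imp_effective_domain)
  have Qa: "quadratic_minorant f (cball a \<delta>) (1 / \<kappa>) a 0"
    using Q[of a 0] stat \<delta> by (simp add: gph_subdifferential_iff)
  have "\<exists>u. u \<in> cball a \<delta> \<and> norm (u - a) \<le> 2 * \<kappa> * norm e \<and>
      quadratic_minorant f (cball a \<delta>) 0 u e" for e
    using exists_resolvent_point[OF lsc proper Qa, of 0 e] \<delta> \<kappa> by (auto simp: mult_ac)
  then obtain m where m: "\<And>e. m e \<in> cball a \<delta>" "\<And>e. norm (m e - a) \<le> 2 * \<kappa> * norm e"
    and m0: "\<And>e. quadratic_minorant f (cball a \<delta>) 0 (m e) e"
    by metis
  define \<rho> where "\<rho> = min (\<delta> / 2) (\<delta> / (4 * \<kappa>))"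
  have \<rho>: "0 < \<rho>" "\<rho> \<le> \<delta> / 2" "2 * \<kappa> * \<rho> \<le> \<delta> / 2"
  proof -
    have "\<rho> \<le> \<delta> / (4 * \<kappa>)" by (simp add: \<rho>_def)
    then show "2 * \<kappa> * \<rho> \<le> \<delta> / 2" using \<kappa> by (simp add: field_simps)
  qed (use \<delta> \<kappa> in \<open>auto simp: \<rho>_def\<close>)
  have Qm: "quadratic_minorant f (cball a \<delta>) (1 / \<kappa>) (m e) e" if e: "e \<in> ball 0 \<rho>" for e
  proof (rule Q)
    have "2 * \<kappa> * norm e \<le> 2 * \<kappa> * \<rho>"
      using e \<kappa> by simp
    then have me: "norm (m e - a) \<le> \<delta> / 2"
      using m(2)[of e] \<rho>(3) by linarith
    then have "m e \<in> interior (cball a \<delta>)"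
      using \<delta> by (simp add: interior_cball dist_norm norm_minus_commute)
    then show "(m e, e) \<in> gph (subdifferential f)"
      using quadratic_minorant_imp_subgradient[OF proper m0] by (simp add: gph_subdifferential_iff)
    show "(m e, e) \<in> cball (a, 0) \<delta>"
      using me e \<rho>(2) by (intro mem_cball_Pair) auto
  qed
  have argmin: "tilt_argmin f a \<delta> e = {m e}" if e: "e \<in> ball 0 \<rho>" for e
  proof -
    have "x = m e" if x: "x \<in> cball a \<delta>" "quadratic_minorant f (cball a \<delta>) 0 x e" for x
      using quadratic_minorant_monotone[OF proper x(2) Qm[OF e] x(1) m(1)] \<kappa>
      by (simp add: divide_le_0_iff)
    then show ?thesis
      using tilt_argmin_minorant[OF proper dom, of \<delta> _ e] m(1) m0 \<delta> by auto
  qed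
  have "\<kappa>-lipschitz_on (ball 0 \<rho>) m"
  proof (rule lipschitz_onI)
    fix e e' :: 'a assume ee: "e \<in> ball 0 \<rho>" "e' \<in> ball 0 \<rho>"
    have "1 / \<kappa> * (norm (m e - m e'))\<^sup>2 \<le> (e - e') \<bullet> (m e - m e')"
      using quadratic_minorant_monotone[OF proper Qm[OF ee(1)] Qm[OF ee(2)] m(1) m(1)] by simp
    also have "\<dots> \<le> norm (e - e') * norm (m e - m e')"
      by (rule norm_cauchy_schwarz)
    finally have "norm (m e - m e') * norm (m e - m e') \<le> (\<kappa> * norm (e - e')) * norm (m e - m e')"
      using \<kappa> by (simp add: power2_eq_square field_simps)
    then have "norm (m e - m e') \<le> \<kappa> * norm (e - e')"
      using \<kappa> by (cases "norm (m e - m e') = 0") (auto simp: mult_le_cancel_right)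
    then show "dist (m e) (m e') \<le> \<kappa> * dist e e'"
      by (simp add: dist_norm)
  qed (use \<kappa> in simp)
  moreover have "m 0 = a"
    using m(2)[of 0] by simp
  ultimately show ?thesis
    unfolding tilt_stable_local_minimizer_def
    using dom \<kappa> \<delta> \<rho>(1) argmin
    by (intro conjI exI[of _ \<delta>] exI[of _ "ball 0 \<rho>"] exI[of _ m]) auto
qed

section \<open>Growth and the graphical derivative\<close>
lemma growth_imp_graphical_derivative_bound:
  fixes f :: "'a::real_inner \<Rightarrow> ereal"
  assumes proper: "proper_fun f" and growth: "uniform_quadratic_growth f a c"
  shows "\<exists>\<eta>>0. graphical_derivative_bound f a c \<eta>"
proof -
  obtain \<delta> where \<delta>: "0 < \<delta>"
    and Q: "\<And>u v. (u, v) \<in> gph (subdifferential f) \<Longrightarrow> (u, v) \<in> cball (a, 0) \<delta> \<Longrightarrow>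
        quadratic_minorant f (cball a \<delta>) c u v"
    using growth unfolding uniform_quadratic_growth_def by blast
  have "c * (norm w)\<^sup>2 \<le> z \<bullet> w"
    if uv: "(u, v) \<in> gph (subdifferential f)" "(u, v) \<in> cball (a, 0) (\<delta> / 2)"
      and z: "z \<in> subgradient_graphical_derivative f u v w" for u v w z
  proof -
    obtain t :: "nat \<Rightarrow> real" and q where t: "\<And>k. 0 < t k" "t \<longlonglongrightarrow> 0" and q: "q \<longlonglongrightarrow> (w, z)"
      and mem: "\<And>k. (u, v) + t k *\<^sub>R q k \<in> gph (subdifferential f)"
      using z unfolding subgradient_graphical_derivative_def tangent_cone_def by blast
    have uv\<delta>: "(u, v) \<in> cball (a, 0) \<delta>"
      using uv(2) \<delta> by auto
    have "(\<lambda>k. (u, v) + t k *\<^sub>R q k) \<longlonglongrightarrow> (u, v) + 0 *\<^sub>R (w, z)"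
      by (intro tendsto_intros t q)
    then have "\<forall>\<^sub>F k in sequentially. (u, v) + t k *\<^sub>R q k \<in> ball (a, 0) \<delta>"
      using uv(2) \<delta> by (intro topological_tendstoD[OF _ open_ball]) auto
    then have ev: "\<forall>\<^sub>F k in sequentially. c * (norm (fst (q k)))\<^sup>2 \<le> snd (q k) \<bullet> fst (q k)"
    proof (rule eventually_mono)
      fix k assume near: "(u, v) + t k *\<^sub>R q k \<in> ball (a, 0) \<delta>"
      define u' v' where "u' = u + t k *\<^sub>R fst (q k)" and "v' = v + t k *\<^sub>R snd (q k)"
      have eq: "(u, v) + t k *\<^sub>R q k = (u', v')"
        by (cases "q k") (simp add: u'_def v'_def)
      have gph': "(u', v') \<in> gph (subdifferential f)" "(u', v') \<in> cball (a, 0) \<delta>"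
        using mem[of k] near by (auto simp: eq)
      have "u' \<in> cball a \<delta>" "u \<in> cball a \<delta>"
        using mem_cball_PairD(1)[OF gph'(2)] mem_cball_PairD(1)[OF uv\<delta>]
        by (auto simp: dist_norm norm_minus_commute)
      then have "c * (norm (u' - u))\<^sup>2 \<le> (v' - v) \<bullet> (u' - u)"
        using quadratic_minorant_monotone[OF proper Q[OF gph'] Q[OF uv(1) uv\<delta>]] by simp
      then have "(t k)\<^sup>2 * (c * (norm (fst (q k)))\<^sup>2) \<le> (t k)\<^sup>2 * (snd (q k) \<bullet> fst (q k))"
        by (simp add: u'_def v'_def power_mult_distrib power2_eq_square mult_ac)
      then show "c * (norm (fst (q k)))\<^sup>2 \<le> snd (q k) \<bullet> fst (q k)"
        using t(1)[of k] by (simp add: mult_le_cancel_left_pos)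
    qed
    have "(\<lambda>k. c * (norm (fst (q k)))\<^sup>2) \<longlonglongrightarrow> c * (norm (fst (w, z)))\<^sup>2"
      "(\<lambda>k. snd (q k) \<bullet> fst (q k)) \<longlonglongrightarrow> snd (w, z) \<bullet> fst (w, z)"
      by (intro tendsto_intros q)+
    then show ?thesis
      using tendsto_le[OF _ _ _ ev] by fastforce
  qed
  then show ?thesis
    using \<delta> unfolding graphical_derivative_bound_def
    by (intro exI[of _ "\<delta> / 2"]) auto
qed

text \<open>
  The resolvent \<open>P\<close> parametrizes the graph near \<open>(a, 0)\<close> by \<open>e \<mapsto> (P e, G e)\<close>. Strong monotonicity
  only gives it the Lipschitz constant \<open>1 / (lam - r) = 1\<close>; the derivative bound improves this to
  \<open>L = 1 / (lam + c)\<close>, because tangents of the graph contain the limits of difference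
  quotients of \<open>P\<close>. The growth constant obtained is \<open>1 / L - lam = c\<close>.
\<close>
lemma graphical_derivative_bound_imp_growth:
  fixes f :: "'a::euclidean_space \<Rightarrow> ereal"
  assumes lsc: "lower_semicontinuous f" and proper: "proper_fun f"
    and prox: "prox_regular f a 0" and sub: "subdifferentially_continuous f a 0"
    and c: "0 < c" and \<eta>: "0 < \<eta>" and bound: "graphical_derivative_bound f a c \<eta>"
  shows "uniform_quadratic_growth f a c"
proof -
  obtain r \<delta>0 where r: "0 < r" and \<delta>0: "0 < \<delta>0"
    and loc: "\<And>u v. (u, v) \<in> gph (subdifferential f) \<Longrightarrow> (u, v) \<in> cball (a, 0) \<delta>0 \<Longrightarrow>
       quadratic_minorant f (cball a \<delta>0) (- r) u v"
    using prox_regular_uniform_minorant[OF proper prox sub] by blast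
  define lam where "lam = r + 1"
  have lam: "1 < lam" using r by (simp add: lam_def)
  have "quadratic_minorant f (cball a \<delta>0) (- r) a 0"
    using loc[of a 0] prox \<delta>0 by (simp add: gph_subdifferential_iff prox_regular_def)
  then have "\<exists>u. u \<in> cball a \<delta>0 \<and> norm (u - a) \<le> 2 * norm e \<and>
      quadratic_minorant f (cball a \<delta>0) (- lam) u (e - lam *\<^sub>R (u - a))" for e
    using exists_resolvent_point[OF lsc proper, of a \<delta>0 "- r" lam e] \<delta>0 by (auto simp: lam_def)
  then obtain P where P: "\<And>e. P e \<in> cball a \<delta>0" "\<And>e. norm (P e - a) \<le> 2 * norm e"
    and PQ: "\<And>e. quadratic_minorant f (cball a \<delta>0) (- lam) (P e) (e - lam *\<^sub>R (P e - a))"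
    by metis
  define G where "G e = e - lam *\<^sub>R (P e - a)" for e
  \<comment> \<open>Since \<open>norm (P e - a) \<le> 2 * norm e\<close> and \<open>norm (G e) \<le> (1 + 2 * lam) * norm e\<close>, this radius keeps
    \<open>(P e, G e)\<close> where both prox-regularity and the derivative bound apply.\<close>
  define \<rho> where "\<rho> = min \<delta>0 \<eta> / (4 * (1 + 2 * lam))"
  have \<rho>: "0 < \<rho>" "(1 + 2 * lam) * \<rho> = min \<delta>0 \<eta> / 4" "2 * \<rho> \<le> min \<delta>0 \<eta> / 4"
  proof -
    show "0 < \<rho>" using \<delta>0 \<eta> lam by (simp add: \<rho>_def)
    show eq: "(1 + 2 * lam) * \<rho> = min \<delta>0 \<eta> / 4"
    proof -
      have cancel: "x * (y / (4 * x)) = y / 4" if "0 < x" for x y :: real using that by simp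
      show ?thesis unfolding \<rho>_def by (rule cancel) (use lam in simp)
    qed
    have "2 * \<rho> \<le> (1 + 2 * lam) * \<rho>"
      using lam \<open>0 < \<rho>\<close> by (intro mult_right_mono) auto
    with eq show "2 * \<rho> \<le> min \<delta>0 \<eta> / 4" by linarith
  qed
  have Pn: "norm (P e - a) \<le> min \<delta>0 \<eta> / 4" "norm (G e) \<le> min \<delta>0 \<eta> / 4" if "e \<in> ball 0 \<rho>" for e
  proof -
    show "norm (P e - a) \<le> min \<delta>0 \<eta> / 4" using P(2)[of e] that \<rho>(3) by simp
    have "norm (G e) \<le> norm e + lam * norm (P e - a)"
      using norm_triangle_ineq4[of e "lam *\<^sub>R (P e - a)"] lam by (simp add: G_def)
    also have "\<dots> \<le> norm e + lam * (2 * norm e)"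
      using P(2)[of e] lam by (intro add_left_mono mult_left_mono) auto
    also have "\<dots> = (1 + 2 * lam) * norm e" by (simp add: algebra_simps)
    also have "\<dots> \<le> (1 + 2 * lam) * \<rho>"
      using that lam by (intro mult_left_mono) auto
    finally show "norm (G e) \<le> min \<delta>0 \<eta> / 4" using \<rho>(2) by simp
  qed
  have gph: "(P e, G e) \<in> gph (subdifferential f)" if "e \<in> ball 0 \<rho>" for e
  proof -
    have "P e \<in> interior (cball a \<delta>0)"
      using Pn(1)[OF that] \<delta>0 by (auto simp: interior_cball dist_norm norm_minus_commute)
    then show ?thesis
      using quadratic_minorant_imp_subgradient[OF proper PQ[of e]]
      by (simp add: gph_subdifferential_iff G_def)
  qed
  have near: "(P e, G e) \<in> cball (a, 0) \<delta>0" "(P e, G e) \<in> cball (a, 0) \<eta>" if "e \<in> ball 0 \<rho>" for e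
    using Pn[OF that] \<delta>0 \<eta> by (intro mem_cball_Pair; simp)+
  have lip1: "1-lipschitz_on (ball 0 \<rho>) P"
  proof (rule lipschitz_onI)
    fix e e' :: 'a assume ee: "e \<in> ball 0 \<rho>" "e' \<in> ball 0 \<rho>"
    have "- r * (norm (P e - P e'))\<^sup>2 \<le> (G e - G e') \<bullet> (P e - P e')"
      using quadratic_minorant_monotone[OF proper loc[OF gph near(1)] loc[OF gph near(1)] P(1) P(1),
          OF ee(1) ee(1) ee(2) ee(2)] by simp
    moreover have "(G e - G e') = (e - e') - lam *\<^sub>R (P e - P e')"
      by (simp add: G_def algebra_simps)
    ultimately have "(norm (P e - P e'))\<^sup>2 \<le> (e - e') \<bullet> (P e - P e')"
      by (simp add: inner_diff_left[of "e - e'"] power2_norm_eq_inner lam_def algebra_simps)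
    also have "\<dots> \<le> norm (e - e') * norm (P e - P e')"
      by (rule norm_cauchy_schwarz)
    finally have "norm (P e - P e') \<le> norm (e - e')"
      by (cases "norm (P e - P e') = 0") (auto simp: power2_eq_square mult_le_cancel_right)
    then show "dist (P e) (P e') \<le> 1 * dist e e'"
      by (simp add: dist_norm)
  qed simp
  define L where "L = 1 / (lam + c)"
  have L: "0 < L" using lam c by (simp add: L_def)
  have lip: "L-lipschitz_on (ball 0 \<rho>) P"
  proof (rule lipschitz_from_directional_limits[OF _ lip1])
    fix y d :: 'a and t :: "nat \<Rightarrow> real" and w
    assume y: "y \<in> ball 0 \<rho>" and t: "\<And>k. 0 < t k" "t \<longlonglongrightarrow> 0" and yt: "\<And>k. y + t k *\<^sub>R d \<in> ball 0 \<rho>"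
      and w: "(\<lambda>k. (1 / t k) *\<^sub>R (P (y + t k *\<^sub>R d) - P y)) \<longlonglongrightarrow> w"
    define q where "q k = (1 / t k) *\<^sub>R (P (y + t k *\<^sub>R d) - P y)" for k
    have "(P y, G y) + t k *\<^sub>R (q k, d - lam *\<^sub>R q k) = (P (y + t k *\<^sub>R d), G (y + t k *\<^sub>R d))" for k
    proof -
      have eq: "P (y + t k *\<^sub>R d) = P y + t k *\<^sub>R q k"
        using t(1)[of k] by (simp add: q_def)
      show ?thesis
        by (simp add: eq G_def algebra_simps)
    qed
    then have "(P y, G y) + t k *\<^sub>R (q k, d - lam *\<^sub>R q k) \<in> gph (subdifferential f)" for k
      using gph[OF yt] by simp
    moreover have "(\<lambda>k. (q k, d - lam *\<^sub>R q k)) \<longlonglongrightarrow> (w, d - lam *\<^sub>R w)"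
      using w unfolding q_def by (intro tendsto_intros)
    ultimately have "d - lam *\<^sub>R w \<in> subgradient_graphical_derivative f (P y) (G y) w"
      unfolding subgradient_graphical_derivative_def tangent_cone_def using t by blast
    then have "c * (norm w)\<^sup>2 \<le> (d - lam *\<^sub>R w) \<bullet> w"
      using bound gph[OF y] near(2)[OF y] unfolding graphical_derivative_bound_def by blast
    then have "(lam + c) * (norm w)\<^sup>2 \<le> d \<bullet> w"
      by (simp add: inner_diff_left power2_norm_eq_inner algebra_simps)
    also have "\<dots> \<le> norm d * norm w"
      by (rule norm_cauchy_schwarz)
    finally have "(lam + c) * norm w * norm w \<le> norm d * norm w"
      by (simp add: power2_eq_square mult.assoc)
    then have "(lam + c) * norm w \<le> norm d"
      by (cases "norm w = 0") (auto simp: mult_le_cancel_right)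
    then show "norm w \<le> L * norm d"
      using lam c by (simp add: L_def field_simps)
  qed (use L in auto)
  \<comment> \<open>For \<open>norm e \<le> \<sigma>\<close> and \<open>norm (x - a) \<le> \<sigma>\<close> one has \<open>norm (x - P e) \<le> 3 * \<sigma>\<close>, so that
    \<open>e + (x - P e) / L\<close> remains in the ball of radius \<open>\<rho>\<close>.\<close>
  define \<sigma> where "\<sigma> = \<rho> / (2 * (1 + 3 * (lam + c)))"
  have \<sigma>: "0 < \<sigma>" "\<sigma> + 3 * (lam + c) * \<sigma> < \<rho>"
  proof -
    show "0 < \<sigma>" using \<rho>(1) lam c by (simp add: \<sigma>_def)
    have "\<sigma> + 3 * (lam + c) * \<sigma> = \<sigma> * (1 + 3 * (lam + c))" by (simp add: algebra_simps)
    also have "\<dots> = \<rho> / 2"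
    proof -
      have cancel: "y / (2 * x) * x = y / 2" if "0 < x" for x y :: real using that by simp
      show ?thesis unfolding \<sigma>_def by (rule cancel) (use lam c in simp)
    qed
    finally show "\<sigma> + 3 * (lam + c) * \<sigma> < \<rho>" using \<rho>(1) by simp
  qed
  have \<sigma>\<rho>: "\<sigma> < \<rho>"
    using \<sigma> lam c by (smt (verit) mult_pos_pos)
  define \<delta> where "\<delta> = min \<delta>0 (\<sigma> / (1 + lam))"
  have \<delta>: "0 < \<delta>" "\<delta> \<le> \<delta>0" "(1 + lam) * \<delta> \<le> \<sigma>" "\<delta> \<le> \<sigma>"
  proof -
    show "0 < \<delta>" "\<delta> \<le> \<delta>0" using \<delta>0 \<sigma> lam by (auto simp: \<delta>_def)
    have "\<delta> \<le> \<sigma> / (1 + lam)" by (simp add: \<delta>_def)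
    then show *: "(1 + lam) * \<delta> \<le> \<sigma>" using lam by (simp add: field_simps)
    have "0 \<le> lam * \<delta>" using lam \<open>0 < \<delta>\<close> by simp
    with * show "\<delta> \<le> \<sigma>" by (simp add: algebra_simps)
  qed
  have "quadratic_minorant f (cball a \<delta>) c u v"
    if uv: "(u, v) \<in> gph (subdifferential f)" "(u, v) \<in> cball (a, 0) \<delta>" for u v
  proof -
    have n: "norm (u - a) \<le> \<delta>" "norm v \<le> \<delta>"
      using mem_cball_PairD[OF uv(2)] by auto
    define e where "e = v + lam *\<^sub>R (u - a)"
    have "norm e \<le> norm v + lam * norm (u - a)"
      using norm_triangle_ineq[of v "lam *\<^sub>R (u - a)"] lam by (simp add: e_def)
    also have "\<dots> \<le> \<delta> + lam * \<delta>"
      using n lam by (intro add_mono mult_left_mono) auto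
    finally have e\<sigma>: "norm e \<le> \<sigma>"
      using \<delta>(3) by (simp add: algebra_simps)
    then have e: "e \<in> ball 0 \<rho>" using \<sigma>\<rho> by simp
    have uv0: "(u, v) \<in> cball (a, 0) \<delta>0" using uv(2) \<delta>(2) by auto
    have u0: "u \<in> cball a \<delta>0"
      using n(1) \<delta>(2) by (simp add: dist_norm norm_minus_commute)
    have eq: "v + lam *\<^sub>R (u - a) = G e + lam *\<^sub>R (P e - a)"
      by (simp add: G_def e_def)
    have "u = P e" "v = G e"
      using resolvent_unique[OF proper loc[OF uv(1) uv0] loc[OF gph[OF e] near(1)[OF e]] u0 P(1) _ eq]
      by (auto simp: lam_def)
    moreover have "quadratic_minorant f (cball a \<delta>) (1 / L - lam) (P e) (e - lam *\<^sub>R (P e - a))"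
    proof (rule lipschitz_resolvent_growth[OF proper _ L lip P(1) PQ e])
      fix x assume x: "x \<in> cball a \<delta>"
      have "norm (x - P e) \<le> norm (x - a) + norm (P e - a)"
        using norm_triangle_ineq4[of "x - a" "P e - a"] by simp
      also have "\<dots> \<le> \<sigma> + 2 * \<sigma>"
        using x P(2)[of e] e\<sigma> \<delta>(4) by (intro add_mono) (auto simp: dist_norm norm_minus_commute)
      finally have "(lam + c) * norm (x - P e) \<le> (lam + c) * (3 * \<sigma>)"
        using lam c by (intro mult_left_mono) auto
      moreover have "norm (e + (1 / L) *\<^sub>R (x - P e)) \<le> norm e + (lam + c) * norm (x - P e)"
        using norm_triangle_ineq[of e "(1 / L) *\<^sub>R (x - P e)"] lam c by (simp add: L_def)
      ultimately have "norm (e + (1 / L) *\<^sub>R (x - P e)) < \<rho>"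
        using \<sigma>(2) e\<sigma> by (simp add: mult_ac)
      then show "x \<in> cball a \<delta>0 \<and> e + (1 / L) *\<^sub>R (x - P e) \<in> ball 0 \<rho>"
        using x \<delta>(2) by simp
    qed simp
    ultimately show ?thesis
      using lam c by (simp add: L_def G_def)
  qed
  with \<delta>(1) show ?thesis
    unfolding uniform_quadratic_growth_def by blast
qed

section \<open>The equivalence and the exact modulus\<close>
lemma tilt_stable_iff_graphical_derivative_bound:
  fixes f :: "'a::euclidean_space \<Rightarrow> ereal"
  assumes "lower_semicontinuous f" "proper_fun f"
    and "prox_regular f a 0" "subdifferentially_continuous f a 0" and "0 < \<kappa>"
  shows "tilt_stable_local_minimizer f a \<kappa> \<longleftrightarrow>
    (\<exists>\<eta>>0. graphical_derivative_bound f a (1 / \<kappa>) \<eta>)"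
proof
  assume "tilt_stable_local_minimizer f a \<kappa>"
  then show "\<exists>\<eta>>0. graphical_derivative_bound f a (1 / \<kappa>) \<eta>"
    using assms by (intro growth_imp_graphical_derivative_bound tilt_stable_imp_growth)
next
  assume "\<exists>\<eta>>0. graphical_derivative_bound f a (1 / \<kappa>) \<eta>"
  then show "tilt_stable_local_minimizer f a \<kappa>"
    using assms graphical_derivative_bound_imp_growth[OF assms(1-4), of "1 / \<kappa>"]
    by (auto intro: growth_imp_tilt_stable simp: prox_regular_def)
qed

lemma zero_mem_tangent_cone:
  assumes "a \<in> S"
  shows "0 \<in> tangent_cone S a"
proof -
  have "(\<lambda>k. 1 / real (Suc k)) \<longlonglongrightarrow> 0"
    using LIMSEQ_inverse_real_of_nat by (simp add: inverse_eq_divide)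
  then show ?thesis
    using assms unfolding tangent_cone_def mem_Collect_eq
    by (intro exI[of _ "\<lambda>k. 1 / real (Suc k)"] exI[of _ "\<lambda>_. 0"]) auto
qed

definition graphical_quotients :: "('a::real_inner \<Rightarrow> ereal) \<Rightarrow> 'a \<Rightarrow> real \<Rightarrow> ereal set" where
  "graphical_quotients f a \<eta> =
     {ereal ((norm w)\<^sup>2) / ereal (z \<bullet> w) | w z u v.
        (u, v) \<in> gph (subdifferential f) \<inter> cball (a, 0) \<eta> \<and>
        z \<in> subgradient_graphical_derivative f u v w}"

text \<open>
  The auxiliary bound with some \<open>c > 0\<close> cannot be dropped: a negative inner product would make the
  quotient negative, hence at most \<open>\<kappa>\<close>, although the bound with \<open>1 / \<kappa>\<close> fails. For \<open>w = 0\<close>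
  the convention \<open>0 / 0 = 0\<close> is used.
\<close>
lemma Sup_graphical_quotients_le_iff:
  fixes f :: "'a::real_inner \<Rightarrow> ereal"
  assumes c: "0 < c" and bound: "graphical_derivative_bound f a c \<eta>" and \<kappa>: "0 < \<kappa>"
  shows "Sup (graphical_quotients f a \<eta>) \<le> ereal \<kappa> \<longleftrightarrow> graphical_derivative_bound f a (1 / \<kappa>) \<eta>"
proof -
  have "ereal ((norm w)\<^sup>2) / ereal (z \<bullet> w) \<le> ereal \<kappa> \<longleftrightarrow> 1 / \<kappa> * (norm w)\<^sup>2 \<le> z \<bullet> w"
    if "c * (norm w)\<^sup>2 \<le> z \<bullet> w" for w z :: 'a
  proof (cases "w = 0")
    case True
    then show ?thesis using \<kappa> by (simp flip: zero_ereal_def)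
  next
    case False
    then have "0 < c * (norm w)\<^sup>2" using c by simp
    with that have "0 < z \<bullet> w" by linarith
    then show ?thesis using \<kappa> by (simp add: field_simps)
  qed
  with bound show ?thesis
    unfolding graphical_quotients_def graphical_derivative_bound_def Sup_le_iff by blast
qed

text \<open>
  The known modulus \<open>\<kappa>0\<close> supplies the auxiliary bound of the preceding lemma for
  radii at most \<open>\<eta>0\<close>; larger radii only enlarge the supremum. Moduli are positive, whereas
  the supremum may vanish, so it is approached from above.
\<close>
lemma tilt_eq_INF_Sup_graphical_quotients:
  fixes f :: "'a::euclidean_space \<Rightarrow> ereal"
  assumes lsc: "lower_semicontinuous f" and proper: "proper_fun f"
    and prox: "prox_regular f a 0" and sub: "subdifferentially_continuous f a 0"
    and tilt: "tilt_stable_local_minimizer f a \<kappa>0"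
  shows "tilt f a = (INF \<eta>\<in>{0<..}. Sup (graphical_quotients f a \<eta>))"
proof (rule antisym)
  note equiv = tilt_stable_iff_graphical_derivative_bound[OF lsc proper prox sub]
  have \<kappa>0: "0 < \<kappa>0" using tilt by (simp add: tilt_stable_local_minimizer_def)
  obtain \<eta>0 where \<eta>0: "0 < \<eta>0" and bound: "graphical_derivative_bound f a (1 / \<kappa>0) \<eta>0"
    using tilt equiv[OF \<kappa>0] by blast
  have bound_mono: "graphical_derivative_bound f a c \<eta>'"
    if "graphical_derivative_bound f a c \<eta>" "\<eta>' \<le> \<eta>" for c \<eta> \<eta>'
  proof -
    have "cball (a, 0) \<eta>' \<subseteq> cball (a, 0 :: 'a) \<eta>" using that(2) by auto
    with that(1) show ?thesis unfolding graphical_derivative_bound_def by blast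
  qed
  show "tilt f a \<le> (INF \<eta>\<in>{0<..}. Sup (graphical_quotients f a \<eta>))"
  proof (rule INF_greatest)
    fix \<eta> :: real assume "\<eta> \<in> {0<..}"
    then have \<eta>: "0 < \<eta>" by simp
    define \<eta>' where "\<eta>' = min \<eta> \<eta>0"
    have \<eta>': "0 < \<eta>'" using \<eta> \<eta>0 by (simp add: \<eta>'_def)
    define s where "s = Sup (graphical_quotients f a \<eta>')"
    have bound': "graphical_derivative_bound f a (1 / \<kappa>0) \<eta>'"
      using bound_mono[OF bound] by (simp add: \<eta>'_def)
    have stat: "(a, 0) \<in> gph (subdifferential f)"
      using prox by (simp add: prox_regular_def gph_subdifferential_iff)
    have "(0, 0) \<in> tangent_cone (gph (subdifferential f)) (a, 0)"
      using zero_mem_tangent_cone[OF stat] by (simp add: zero_prod_def)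
    then have "ereal ((norm (0::'a))\<^sup>2) / ereal (0 \<bullet> (0::'a)) \<in> graphical_quotients f a \<eta>'"
      using stat \<eta>' unfolding graphical_quotients_def subgradient_graphical_derivative_def mem_Collect_eq
      by (intro exI[of _ "0::'a"] exI[of _ a]) auto
    then have "0 \<in> graphical_quotients f a \<eta>'"
      by (simp flip: zero_ereal_def)
    then have s0: "0 \<le> s" unfolding s_def by (rule Sup_upper)
    have le: "tilt f a \<le> ereal \<kappa>" if "0 < \<kappa>" "s \<le> ereal \<kappa>" for \<kappa>
    proof -
      have "graphical_derivative_bound f a (1 / \<kappa>) \<eta>'"
        using that Sup_graphical_quotients_le_iff[OF _ bound' that(1)] \<kappa>0 by (simp add: s_def)
      then have "tilt_stable_local_minimizer f a \<kappa>"
        using equiv[OF that(1)] \<eta>' by blast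
      then show ?thesis
        unfolding tilt_def by (intro Inf_lower) blast
    qed
    have "tilt f a \<le> s"
    proof (cases s)
      case (real x)
      have "tilt f a \<le> s + ereal \<epsilon>" if "0 < \<epsilon>" for \<epsilon>
        using le[of "x + \<epsilon>"] that s0 real by simp
      then show ?thesis using ereal_le_epsilon2 by blast
    qed (use s0 in auto)
    also have "s \<le> Sup (graphical_quotients f a \<eta>)"
      unfolding s_def
    proof (rule Sup_subset_mono)
      have "cball (a, 0) \<eta>' \<subseteq> cball (a, 0 :: 'a) \<eta>" by (auto simp: \<eta>'_def)
      then show "graphical_quotients f a \<eta>' \<subseteq> graphical_quotients f a \<eta>"
        unfolding graphical_quotients_def by blast
    qed
    finally show "tilt f a \<le> Sup (graphical_quotients f a \<eta>)" .
  qed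
  show "(INF \<eta>\<in>{0<..}. Sup (graphical_quotients f a \<eta>)) \<le> tilt f a"
    unfolding tilt_def
  proof (rule Inf_greatest)
    fix y assume "y \<in> {ereal \<kappa> |\<kappa>. tilt_stable_local_minimizer f a \<kappa>}"
    then obtain \<kappa> where y: "y = ereal \<kappa>" and \<kappa>: "tilt_stable_local_minimizer f a \<kappa>" by blast
    then have pos: "0 < \<kappa>" by (simp add: tilt_stable_local_minimizer_def)
    then obtain \<eta> where \<eta>: "0 < \<eta>" "graphical_derivative_bound f a (1 / \<kappa>) \<eta>"
      using equiv \<kappa> by blast
    have "Sup (graphical_quotients f a \<eta>) \<le> y"
      using Sup_graphical_quotients_le_iff[OF _ \<eta>(2) pos] \<eta>(2) pos by (simp add: y)
    then show "(INF \<eta>\<in>{0<..}. Sup (graphical_quotients f a \<eta>)) \<le> y"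
      using \<eta>(1) by (rule_tac INF_lower2[of \<eta>]) simp_all
  qed
qed

theorem theorem3p3:
  fixes f :: "real ^ 'n \<Rightarrow> ereal" and xbar :: "real ^ 'n"
  assumes lsc: "lower_semicontinuous f"
    and proper: "proper_fun f"
    and dom: "xbar \<in> effective_domain f"
    and stationary: "0 \<in> subdifferential f xbar"
    and prox: "prox_regular f xbar 0"
    and subcont: "subdifferentially_continuous f xbar 0"
  shows "(\<forall>\<kappa>>0. tilt_stable_local_minimizer f xbar \<kappa> \<longleftrightarrow>
            (\<exists>\<eta>>0. \<forall>w z u v.
               (u, v) \<in> gph (subdifferential f) \<inter> cball (xbar, 0) \<eta> \<longrightarrow>
               z \<in> subgradient_graphical_derivative f u v w \<longrightarrow>
               z \<bullet> w \<ge> 1 / \<kappa> * (norm w)\<^sup>2)) \<and>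
         ((\<exists>\<kappa>>0. tilt_stable_local_minimizer f xbar \<kappa>) \<longrightarrow>
            tilt f xbar =
              (INF \<eta>\<in>{0::real<..}.
                 Sup {ereal ((norm w)\<^sup>2) / ereal (z \<bullet> w) | w z u v.
                        (u, v) \<in> gph (subdifferential f) \<inter> cball (xbar, 0) \<eta> \<and>
                        z \<in> subgradient_graphical_derivative f u v w}))"
proof (intro conjI allI impI)
  fix \<kappa> :: real assume "0 < \<kappa>"
  from tilt_stable_iff_graphical_derivative_bound[OF lsc proper prox subcont this]
  show "tilt_stable_local_minimizer f xbar \<kappa> \<longleftrightarrow>
      (\<exists>\<eta>>0. \<forall>w z u v.
         (u, v) \<in> gph (subdifferential f) \<inter> cball (xbar, 0) \<eta> \<longrightarrow>
         z \<in> subgradient_graphical_derivative f u v w \<longrightarrow>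
         z \<bullet> w \<ge> 1 / \<kappa> * (norm w)\<^sup>2)"
    unfolding graphical_derivative_bound_def .
next
  assume "\<exists>\<kappa>>0. tilt_stable_local_minimizer f xbar \<kappa>"
  then obtain \<kappa> where "tilt_stable_local_minimizer f xbar \<kappa>"
    by blast
  from tilt_eq_INF_Sup_graphical_quotients[OF lsc proper prox subcont this]
  show "tilt f xbar =
      (INF \<eta>\<in>{0::real<..}.
         Sup {ereal ((norm w)\<^sup>2) / ereal (z \<bullet> w) | w z u v.
                (u, v) \<in> gph (subdifferential f) \<inter> cball (xbar, 0) \<eta> \<and>
                z \<in> subgradient_graphical_derivative f u v w})"
    unfolding graphical_quotients_def .
qed

end
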